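(* Let $R$ be an associative ring with $1$ which is not commutative, and let $C$ be the center of $R$. Write $(x,y)=xy-yx$ for $x,y\in R$. Assume that (i) every non-zero commutator $(x,y)$, $x,y\in R$, is not a divisor of zero in $R$; (ii) $(x,y)^2\in C$ for all $x,y\in R$. Then: (1) $R$ contains no divisors of zero. (2) If, in addition, the characteristic of $R$ is not $2$, then the localization of $R$ at $C$ is a quaternion division algebra whose center is the fraction field of $C$.
   Context: Commutators: a commutator in $R$ is an element of the form $(x,y)=xy-yx$ with $x,y\in R$. Zero divisors: if $x,y\in R$ are non-zero elements with $xy=0$, then both $x$ and $y$ are called zero divisors (divisors of zero) in $R$. Thus left and right zero divisors are both included, and $0$ itself is not counted as a zero divisor. Localization: given that $R$ has no zero divisors (conclusion (1)), the localization of $R$ at $C$, denoted $R//C$, is the ring of formal fractions $x/c$ with $x\in R$, $c\in C$, $c\neq 0$, where $x/c=y/d$ if and only if $dx=cy$, $(x/c)+(y/d)=(dx+cy)/(cd)$, and $(x/c)(y/d)=(xy)/(cd)$. Quaternion division algebra: a quaternion division algebra over a field $\mathbb{F}$ (of characteristic not $2$) is a division algebra $D=\mathbb{F}+\mathbb{F}i+\mathbb{F}j+\mathbb{F}k$ that is $4$-dimensional over $\mathbb{F}$ with basis $1,i,j,k$, where $i^2,j^2\in\mathbb{F}$ and $k=ij=-ji$. *)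

theory Defs
  imports
    "HOL-Algebra.Embedded_Algebras"
    "HOL-Algebra.QuotRing"
    "HOL-Algebra.Multiplicative_Group"
begin

definition center :: "('a, 'b) ring_scheme \<Rightarrow> 'a set"
  where "center R = {z \<in> carrier R. \<forall>x\<in>carrier R. z \<otimes>\<^bsub>R\<^esub> x = x \<otimes>\<^bsub>R\<^esub> z}"

definition commutator :: "('a, 'b) ring_scheme \<Rightarrow> 'a \<Rightarrow> 'a \<Rightarrow> 'a"
  where "commutator R x y = x \<otimes>\<^bsub>R\<^esub> y \<ominus>\<^bsub>R\<^esub> y \<otimes>\<^bsub>R\<^esub> x"

definition zero_divisor :: "('a, 'b) ring_scheme \<Rightarrow> 'a \<Rightarrow> bool"
  where "zero_divisor R x \<longleftrightarrow> x \<in> carrier R \<and> x \<noteq> \<zero>\<^bsub>R\<^esub> \<and>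
    (\<exists>y\<in>carrier R. y \<noteq> \<zero>\<^bsub>R\<^esub> \<and> (x \<otimes>\<^bsub>R\<^esub> y = \<zero>\<^bsub>R\<^esub> \<or> y \<otimes>\<^bsub>R\<^esub> x = \<zero>\<^bsub>R\<^esub>))"

(* ord is 0 for elements of infinite order, which matches characteristic 0 *)
definition ring_char :: "('a, 'b) ring_scheme \<Rightarrow> nat"
  where "ring_char R = group.ord (add_monoid R) \<one>\<^bsub>R\<^esub>"

text \<open>
  Formal fractions with numerators in a ring \<open>R\<close> and denominators in \<open>S - {0}\<close>. The set \<open>S\<close> is
  meant to be a central subring without zero divisors of \<open>R\<close>; only then are the relation an
  equivalence and the operations independent of representatives (see the lemmas below).
\<close>

definition frac_pairs :: "('a, 'b) ring_scheme \<Rightarrow> 'a set \<Rightarrow> ('a \<times> 'a) set"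
  where "frac_pairs R S = carrier R \<times> (S - {\<zero>\<^bsub>R\<^esub>})"

definition frac_rel :: "('a, 'b) ring_scheme \<Rightarrow> 'a set \<Rightarrow> (('a \<times> 'a) \<times> ('a \<times> 'a)) set"
  where "frac_rel R S = {((x, c), (y, d)).
    (x, c) \<in> frac_pairs R S \<and> (y, d) \<in> frac_pairs R S \<and> d \<otimes>\<^bsub>R\<^esub> x = c \<otimes>\<^bsub>R\<^esub> y}"

definition ring_frac :: "('a, 'b) ring_scheme \<Rightarrow> 'a set \<Rightarrow> 'a \<Rightarrow> 'a \<Rightarrow> ('a \<times> 'a) set"
  where "ring_frac R S x c = frac_rel R S `` {(x, c)}"

definition fractions :: "('a, 'b) ring_scheme \<Rightarrow> 'a set \<Rightarrow> ('a \<times> 'a) set ring"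
  where "fractions R S =
    \<lparr> carrier = frac_pairs R S // frac_rel R S,
      mult = (\<lambda>X Y. \<Union>(x, c)\<in>X. \<Union>(y, d)\<in>Y. ring_frac R S (x \<otimes>\<^bsub>R\<^esub> y) (c \<otimes>\<^bsub>R\<^esub> d)),
      one = ring_frac R S \<one>\<^bsub>R\<^esub> \<one>\<^bsub>R\<^esub>,
      zero = ring_frac R S \<zero>\<^bsub>R\<^esub> \<one>\<^bsub>R\<^esub>,
      add = (\<lambda>X Y. \<Union>(x, c)\<in>X. \<Union>(y, d)\<in>Y.
        ring_frac R S (d \<otimes>\<^bsub>R\<^esub> x \<oplus>\<^bsub>R\<^esub> c \<otimes>\<^bsub>R\<^esub> y) (c \<otimes>\<^bsub>R\<^esub> d)) \<rparr>"

definition localization :: "('a, 'b) ring_scheme \<Rightarrow> ('a \<times> 'a) set ring"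
  where "localization R = fractions R (center R)"

definition center_fraction_field :: "('a, 'b) ring_scheme \<Rightarrow> ('a \<times> 'a) set ring"
  where "center_fraction_field R = fractions (R\<lparr>carrier := center R\<rparr>) (center R)"

definition division_ring :: "('a, 'b) ring_scheme \<Rightarrow> bool"
  where "division_ring D \<longleftrightarrow> ring D \<and> Units D = carrier D - {\<zero>\<^bsub>D\<^esub>}"

text \<open>
  The base field is given as a central subfield \<open>F\<close> of \<open>D\<close>; \<^const>\<open>ring.Span\<close> and
  \<^const>\<open>ring.independent\<close> use multiplication by elements of \<open>F\<close> on the left.
\<close>

definition quaternion_division_algebra :: "'a set \<Rightarrow> ('a, 'b) ring_scheme \<Rightarrow> bool"
  where "quaternion_division_algebra F D \<longleftrightarrow>
    division_ring D \<and> subfield F D \<and> F \<subseteq> center D \<and> ring_char (D\<lparr>carrier := F\<rparr>) \<noteq> 2 \<and>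
    (\<exists>i\<in>carrier D. \<exists>j\<in>carrier D. \<exists>k\<in>carrier D.
      i \<otimes>\<^bsub>D\<^esub> i \<in> F \<and> j \<otimes>\<^bsub>D\<^esub> j \<in> F \<and>
      k = i \<otimes>\<^bsub>D\<^esub> j \<and> k = \<ominus>\<^bsub>D\<^esub> (j \<otimes>\<^bsub>D\<^esub> i) \<and>
      ring.independent D F [\<one>\<^bsub>D\<^esub>, i, j, k] \<and>
      ring.Span D F [\<one>\<^bsub>D\<^esub>, i, j, k] = carrier D)"

text \<open>Well-definedness of fractions.\<close>

locale central_denominators = ring R for R (structure) +
  fixes S :: "'a set"
  assumes no_zero_divisors: "\<And>x. \<not> zero_divisor R x"
    and one_neq_zero: "\<one> \<noteq> \<zero>"
    and S_subring: "subring S R"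
    and S_central: "S \<subseteq> center R"
begin

lemma S_carrier: "c \<in> S \<Longrightarrow> c \<in> carrier R"
  using S_central by (auto simp: center_def)

lemma S_comm: "c \<in> S \<Longrightarrow> x \<in> carrier R \<Longrightarrow> x \<otimes> c = c \<otimes> x"
  using S_central by (auto simp: center_def)

lemma S_lcomm:
  "c \<in> S \<Longrightarrow> x \<in> carrier R \<Longrightarrow> y \<in> carrier R \<Longrightarrow> x \<otimes> (c \<otimes> y) = c \<otimes> (x \<otimes> y)"
  using m_assoc[of x c y] m_assoc[of c x y] S_comm[of c x] S_carrier[of c] by simp

lemma integral:
  assumes "x \<in> carrier R" "y \<in> carrier R" "x \<otimes> y = \<zero>" "x \<noteq> \<zero>"
  shows "y = \<zero>"
proof (rule ccontr)
  assume "y \<noteq> \<zero>"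
  with assms have "zero_divisor R x" unfolding zero_divisor_def by blast
  with no_zero_divisors show False by blast
qed

lemma cancel:
  assumes "c \<in> carrier R" "c \<noteq> \<zero>" "x \<in> carrier R" "y \<in> carrier R" "c \<otimes> x = c \<otimes> y"
  shows "x = y"
proof -
  have "c \<otimes> (x \<ominus> y) = c \<otimes> x \<oplus> \<ominus> (c \<otimes> y)"
    using assms(1,3,4) r_distr[of x "\<ominus> y" c] r_minus[of c y] by (simp only: a_minus_def a_inv_closed)
  also have "\<dots> = \<zero>"
    unfolding assms(5) using assms(1,4) by (intro r_neg m_closed)
  finally have "x \<ominus> y = \<zero>"
    by (rule integral[OF assms(1) minus_closed[OF assms(3,4)] _ assms(2)])
  then show ?thesis using r_right_minus_eq[OF assms(3,4)] by blast
qed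

lemma S_mult:
  assumes "c \<in> S - {\<zero>}" "d \<in> S - {\<zero>}" shows "c \<otimes> d \<in> S - {\<zero>}"
proof -
  have "c \<otimes> d \<in> S" using subringE(6)[OF S_subring] assms by blast
  moreover have "c \<otimes> d \<noteq> \<zero>" using integral[of c d] assms S_carrier by blast
  ultimately show ?thesis by blast
qed

lemma frac_rel_iff:
  "((x, c), (y, d)) \<in> frac_rel R S \<longleftrightarrow> x \<in> carrier R \<and> c \<in> S - {\<zero>} \<and>
    y \<in> carrier R \<and> d \<in> S - {\<zero>} \<and> d \<otimes> x = c \<otimes> y"
  unfolding frac_rel_def frac_pairs_def by blast

lemma equiv_frac_rel: "equiv (frac_pairs R S) (frac_rel R S)"
proof (rule equivI)
  show "frac_rel R S \<subseteq> frac_pairs R S \<times> frac_pairs R S"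
    unfolding frac_rel_def by blast
  show "refl_on (frac_pairs R S) (frac_rel R S)"
    unfolding refl_on_def frac_rel_def by blast
  show "sym (frac_rel R S)"
    unfolding sym_def frac_rel_def by fastforce
  show "trans (frac_rel R S)"
  proof (rule transI)
    fix p q r
    assume pq: "(p, q) \<in> frac_rel R S" and qr: "(q, r) \<in> frac_rel R S"
    obtain x c y d z e where pqr: "p = (x, c)" "q = (y, d)" "r = (z, e)"
      by (metis surj_pair)
    have x: "x \<in> carrier R" and y: "y \<in> carrier R" and z: "z \<in> carrier R"
      and c: "c \<in> S - {\<zero>}" and d: "d \<in> S - {\<zero>}" and e: "e \<in> S - {\<zero>}"
      and xy: "d \<otimes> x = c \<otimes> y" and yz: "e \<otimes> y = d \<otimes> z"
      using pq qr unfolding pqr frac_rel_iff by blast+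
    have cS: "c \<in> S" and dS: "d \<in> S" and eS: "e \<in> S" and d0: "d \<noteq> \<zero>"
      using c d e by blast+
    note cl = S_carrier[OF cS] S_carrier[OF dS] S_carrier[OF eS]
    have "d \<otimes> (e \<otimes> x) = e \<otimes> (d \<otimes> x)" by (rule S_lcomm[OF eS cl(2) x])
    also have "\<dots> = e \<otimes> (c \<otimes> y)" by (simp only: xy)
    also have "\<dots> = c \<otimes> (e \<otimes> y)" by (rule S_lcomm[OF cS cl(3) y])
    also have "\<dots> = c \<otimes> (d \<otimes> z)" by (simp only: yz)
    also have "\<dots> = d \<otimes> (c \<otimes> z)" by (rule S_lcomm[OF dS cl(1) z])
    finally have "e \<otimes> x = c \<otimes> z"
      by (rule cancel[OF cl(2) d0 m_closed[OF cl(3) x] m_closed[OF cl(1) z]])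
    then show "(p, r) \<in> frac_rel R S"
      unfolding pqr frac_rel_iff using x c z e by blast
  qed
qed

lemma frac_eq_iff:
  assumes "x \<in> carrier R" "c \<in> S - {\<zero>}" "y \<in> carrier R" "d \<in> S - {\<zero>}"
  shows "ring_frac R S x c = ring_frac R S y d \<longleftrightarrow> d \<otimes> x = c \<otimes> y"
proof -
  have "(x, c) \<in> frac_pairs R S" "(y, d) \<in> frac_pairs R S"
    unfolding frac_pairs_def using assms by blast+
  from eq_equiv_class_iff[OF equiv_frac_rel this] show ?thesis
    unfolding ring_frac_def frac_rel_iff using assms by blast
qed

lemma frac_mult:
  assumes "x \<in> carrier R" "c \<in> S - {\<zero>}" "y \<in> carrier R" "d \<in> S - {\<zero>}"
  shows "ring_frac R S x c \<otimes>\<^bsub>fractions R S\<^esub> ring_frac R S y d = ring_frac R S (x \<otimes> y) (c \<otimes> d)"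
proof -
  have "congruent2 (frac_rel R S) (frac_rel R S)
      (\<lambda>p q. (\<lambda>(x, c). (\<lambda>(y, d). ring_frac R S (x \<otimes> y) (c \<otimes> d)) q) p)"
  proof (rule congruent2I', clarify)
    fix x c x' c' y d y' d'
    assume 1: "((x, c), (x', c')) \<in> frac_rel R S" and 2: "((y, d), (y', d')) \<in> frac_rel R S"
    have h: "x \<in> carrier R" "x' \<in> carrier R" "c \<in> S - {\<zero>}" "c' \<in> S - {\<zero>}" "c' \<otimes> x = c \<otimes> x'"
      "y \<in> carrier R" "y' \<in> carrier R" "d \<in> S - {\<zero>}" "d' \<in> S - {\<zero>}" "d' \<otimes> y = d \<otimes> y'"
      using 1 2 by (auto simp: frac_rel_def frac_pairs_def)
    have g: "c \<in> S" "c' \<in> S" "d \<in> S" "d' \<in> S" using h by auto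
    note cl = S_carrier[OF g(1)] S_carrier[OF g(2)] S_carrier[OF g(3)] S_carrier[OF g(4)]
    have "c' \<otimes> d' \<otimes> (x \<otimes> y) = (c' \<otimes> x) \<otimes> (d' \<otimes> y)"
      using h(1-4,6-9) cl g by (simp add: m_assoc S_lcomm[where x = x])
    also have "\<dots> = (c \<otimes> x') \<otimes> (d \<otimes> y')"
      by (simp only: h(5) h(10))
    also have "\<dots> = c \<otimes> d \<otimes> (x' \<otimes> y')"
      using h(1-4,6-9) cl g by (simp add: m_assoc S_lcomm[where x = x'])
    finally show "ring_frac R S (x \<otimes> y) (c \<otimes> d) = ring_frac R S (x' \<otimes> y') (c' \<otimes> d')"
      using h S_mult by (subst frac_eq_iff) auto
  qed
  from UN_equiv_class2[OF equiv_frac_rel equiv_frac_rel this, of "(x, c)" "(y, d)"]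
  show ?thesis using assms
    by (simp add: ring_frac_def fractions_def frac_pairs_def case_prod_unfold)
qed

lemma frac_add:
  assumes "x \<in> carrier R" "c \<in> S - {\<zero>}" "y \<in> carrier R" "d \<in> S - {\<zero>}"
  shows "ring_frac R S x c \<oplus>\<^bsub>fractions R S\<^esub> ring_frac R S y d = ring_frac R S (d \<otimes> x \<oplus> c \<otimes> y) (c \<otimes> d)"
proof -
  have "congruent2 (frac_rel R S) (frac_rel R S)
      (\<lambda>p q. (\<lambda>(x, c). (\<lambda>(y, d). ring_frac R S (d \<otimes> x \<oplus> c \<otimes> y) (c \<otimes> d)) q) p)"
  proof (rule congruent2I', clarify)
    fix x c x' c' y d y' d'
    assume 1: "((x, c), (x', c')) \<in> frac_rel R S" and 2: "((y, d), (y', d')) \<in> frac_rel R S"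
    have h: "x \<in> carrier R" "x' \<in> carrier R" "c \<in> S - {\<zero>}" "c' \<in> S - {\<zero>}" "c' \<otimes> x = c \<otimes> x'"
      "y \<in> carrier R" "y' \<in> carrier R" "d \<in> S - {\<zero>}" "d' \<in> S - {\<zero>}" "d' \<otimes> y = d \<otimes> y'"
      using 1 2 by (auto simp: frac_rel_def frac_pairs_def)
    have g: "c \<in> S" "c' \<in> S" "d \<in> S" "d' \<in> S" using h by auto
    note cl = S_carrier[OF g(1)] S_carrier[OF g(2)] S_carrier[OF g(3)] S_carrier[OF g(4)]
    have "c' \<otimes> d' \<otimes> (d \<otimes> x \<oplus> c \<otimes> y) = d \<otimes> (d' \<otimes> (c' \<otimes> x)) \<oplus> c \<otimes> (c' \<otimes> (d' \<otimes> y))"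
      using h(1-4,6-9) cl g by (simp add: m_assoc r_distr S_lcomm)
    also have "\<dots> = d \<otimes> (d' \<otimes> (c \<otimes> x')) \<oplus> c \<otimes> (c' \<otimes> (d \<otimes> y'))"
      unfolding h(5) h(10) ..
    also have "\<dots> = c \<otimes> d \<otimes> (d' \<otimes> x' \<oplus> c' \<otimes> y')"
      using h(1-4,6-9) cl g by (simp add: m_assoc r_distr S_lcomm)
    finally show "ring_frac R S (d \<otimes> x \<oplus> c \<otimes> y) (c \<otimes> d) =
        ring_frac R S (d' \<otimes> x' \<oplus> c' \<otimes> y') (c' \<otimes> d')"
      using h cl S_mult by (subst frac_eq_iff) auto
  qed
  from UN_equiv_class2[OF equiv_frac_rel equiv_frac_rel this, of "(x, c)" "(y, d)"]
  show ?thesis using assms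
    by (simp add: ring_frac_def fractions_def frac_pairs_def case_prod_unfold)
qed

end

end

theory Submission
  imports Defs
begin

text \<open>
  If \<open>x y = 0\<close> with \<open>x, y \<noteq> 0\<close>, the commutator \<open>(x, y) = - y x\<close> squares to \<open>0\<close>, so \<open>y x = 0\<close>. Applied
  to \<open>x (y r) = 0\<close> this gives \<open>y R x = 0\<close> and symmetrically \<open>x R y = 0\<close>; hence \<open>(x, r) y = 0\<close> for all
  \<open>r\<close> and \<open>x\<close> is central. But then \<open>x (a, b) = (x a, b)\<close> is a commutator annihilated by \<open>y\<close>, which
  is impossible for \<open>(a, b) \<noteq> 0\<close>.

  For the second part let \<open>v = (x, y) \<noteq> 0\<close> and \<open>i = (x, v)\<close>, \<open>j = v\<close>. As \<open>v\<^sup>2\<close> is central, \<open>i\<close> and \<open>j\<close>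
  anticommute. If \<open>z\<close> commutes with \<open>i\<close> and \<open>j\<close>, then \<open>(i, z j) = 2 z i j\<close>, so \<open>z\<^sup>2\<close> is central; the
  same holds for \<open>z + 1\<close>, so \<open>z\<close> is central. The same trick applied to \<open>(x v)\<^sup>2 = x\<^sup>2 v\<^sup>2\<close> shows
  \<open>i \<noteq> 0\<close>. Splitting elements into eigenvectors of conjugation by \<open>i\<close> and \<open>j\<close> shows that \<open>1, i, j, ij\<close>
  span. A non-central \<open>r\<close> with \<open>v = (r, y) \<noteq> 0\<close> is invertible because \<open>r (v r v) = (r, r y)\<^sup>2\<close> is
  central and non-zero.
\<close>

section \<open>Centers and commutators\<close>

context ring
begin

lemma center_carrier: "z \<in> center R \<Longrightarrow> z \<in> carrier R"
  by (simp add: center_def)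

lemma center_comm: "z \<in> center R \<Longrightarrow> x \<in> carrier R \<Longrightarrow> z \<otimes> x = x \<otimes> z"
  by (simp add: center_def)

lemma centerI:
  "z \<in> carrier R \<Longrightarrow> (\<And>x. x \<in> carrier R \<Longrightarrow> z \<otimes> x = x \<otimes> z) \<Longrightarrow> z \<in> center R"
  by (simp add: center_def)

lemma center_subcring: "subcring (center R) R"
proof (rule subcringI[OF subringI])
  fix a b assume a: "a \<in> center R" and b: "b \<in> center R"
  note [simp] = center_carrier[OF a] center_carrier[OF b]
  show "a \<otimes> b \<in> center R"
  proof (rule centerI)
    fix x assume [simp]: "x \<in> carrier R"
    have "a \<otimes> b \<otimes> x = a \<otimes> (x \<otimes> b)" using center_comm[OF b, of x] by (simp add: m_assoc)
    also have "\<dots> = x \<otimes> (a \<otimes> b)"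
      using center_comm[OF a, of x] m_assoc[of a x b] m_assoc[of x a b] by simp
    finally show "a \<otimes> b \<otimes> x = x \<otimes> (a \<otimes> b)" .
  qed simp
  show "a \<oplus> b \<in> center R"
    using center_comm[OF a] center_comm[OF b] by (intro centerI) (simp_all add: l_distr r_distr)
  show "a \<otimes> b = b \<otimes> a" using center_comm[OF a, of b] by simp
next
  fix a assume a: "a \<in> center R"
  show "\<ominus> a \<in> center R"
    using center_carrier[OF a] center_comm[OF a] by (intro centerI) (simp_all add: l_minus r_minus)
qed (auto simp: center_def)

text \<open>The order is zero, one, additive inverse, product, sum; items 2 and 4 are cited by
  number further on.\<close>

lemmas center_closed =
  subringE(2,3,5,6,7)[OF subcring.axioms(1)[OF center_subcring]]

lemma noncommuting_obtains:
  assumes "\<not> cring R"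
  obtains x y where "x \<in> carrier R" "y \<in> carrier R" "x \<otimes> y \<noteq> y \<otimes> x"
  using assms cring.intro[OF ring_axioms] comm_monoid.intro[OF monoid_axioms]
  unfolding comm_monoid_axioms_def by blast

lemma commutator_closed [simp]:
  "x \<in> carrier R \<Longrightarrow> y \<in> carrier R \<Longrightarrow> commutator R x y \<in> carrier R"
  by (simp add: commutator_def)

lemma commutator_eq_zero_iff:
  "x \<in> carrier R \<Longrightarrow> y \<in> carrier R \<Longrightarrow> commutator R x y = \<zero> \<longleftrightarrow> x \<otimes> y = y \<otimes> x"
  by (simp add: commutator_def r_right_minus_eq)

lemma commutator_mult_self:
  "x \<in> carrier R \<Longrightarrow> y \<in> carrier R \<Longrightarrow>
    commutator R x (x \<otimes> y) = x \<otimes> commutator R x y"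
  unfolding commutator_def by algebra

lemma not_center_obtains:
  assumes "x \<in> carrier R" "x \<notin> center R"
  obtains y where "y \<in> carrier R" "commutator R x y \<noteq> \<zero>"
  using assms commutator_eq_zero_iff by (auto simp: center_def)

text \<open>Serves the independence proofs, where left and right multiples by an anticommuting
  element are added and the mixed terms carry opposite signs.\<close>

lemma add_cancel:
  "a \<in> carrier R \<Longrightarrow> b \<in> carrier R \<Longrightarrow> x \<in> carrier R \<Longrightarrow> (a \<oplus> x) \<oplus> (b \<oplus> \<ominus> x) = a \<oplus> b"
  by algebra

text \<open>The right-nested form of anticommutation, as it is met once \<open>m_assoc\<close> has
  moved all brackets to the right.\<close>

lemma anticommuting_mult:
  assumes "i \<in> carrier R" "j \<in> carrier R" "i \<otimes> j = \<ominus> (j \<otimes> i)" "x \<in> carrier R"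
  shows "i \<otimes> (j \<otimes> x) = \<ominus> (j \<otimes> (i \<otimes> x))"
  using assms m_assoc[of i j x] m_assoc[of j i x] l_minus[of "j \<otimes> i" x] by simp

lemma anticommuting_prod_commutes:
  assumes "x \<in> carrier R" "y \<in> carrier R" "u \<in> carrier R"
    and xu: "x \<otimes> u = \<ominus> (u \<otimes> x)" and yu: "y \<otimes> u = \<ominus> (u \<otimes> y)"
  shows "x \<otimes> y \<otimes> u = u \<otimes> (x \<otimes> y)"
proof -
  have "x \<otimes> y \<otimes> u = \<ominus> (x \<otimes> u \<otimes> y)" using assms(1-3) yu by (simp add: m_assoc r_minus)
  then show ?thesis unfolding xu using assms(1-3) by (simp add: l_minus m_assoc)
qed

section \<open>Absence of zero divisors\<close>

lemma no_zero_divisors_if_commutators_regular: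
  assumes noncomm: "\<not> cring R"
    and regular: "\<And>x y. x \<in> carrier R \<Longrightarrow> y \<in> carrier R \<Longrightarrow> commutator R x y \<noteq> \<zero> \<Longrightarrow>
           \<not> zero_divisor R (commutator R x y)"
    and x: "x \<in> carrier R" "x \<noteq> \<zero>" and y: "y \<in> carrier R" "y \<noteq> \<zero>"
  shows "x \<otimes> y \<noteq> \<zero>"
proof
  assume xy: "x \<otimes> y = \<zero>"
  have left: "commutator R a b = \<zero>"
    if "a \<in> carrier R" "b \<in> carrier R" "z \<in> carrier R" "z \<noteq> \<zero>"
      "commutator R a b \<otimes> z = \<zero> \<or> z \<otimes> commutator R a b = \<zero>" for a b z
    using regular[of a b] that unfolding zero_divisor_def by auto
  \<comment> \<open>Since \<open>a \<otimes> b\<close> is zero, (b, a) is just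
    \<open>b \<otimes> a\<close>, and its square contains the factor \<open>a \<otimes> b\<close>.
    If it were nonzero, it would be a commutator annihilated by itself.\<close>
  have swap: "b \<otimes> a = \<zero>"
    if ab: "a \<in> carrier R" "b \<in> carrier R" "a \<otimes> b = \<zero>" for a b
  proof (rule ccontr)
    assume nz: "b \<otimes> a \<noteq> \<zero>"
    have c: "commutator R b a = b \<otimes> a" using ab by (simp add: commutator_def minus_eq)
    have "b \<otimes> a \<otimes> (b \<otimes> a) = b \<otimes> (a \<otimes> b) \<otimes> a" using ab(1,2) by (simp add: m_assoc)
    then have "b \<otimes> a \<otimes> (b \<otimes> a) = \<zero>" using ab by simp
    then have "commutator R b a = \<zero>" using left[of b a "b \<otimes> a"] ab nz c by simp
    with nz c show False by simp
  qed
  \<comment> \<open>Exchanging the two factors of a (b r) = 0 puts \<open>r\<close> in the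
    middle.\<close>
  have sandwich: "b \<otimes> r \<otimes> a = \<zero>"
    if "a \<in> carrier R" "b \<in> carrier R" "r \<in> carrier R" "a \<otimes> b = \<zero>" for a b r
    using swap[of a "b \<otimes> r"] that m_assoc[of a b r] by simp
  have "x \<in> center R"
  proof (rule centerI)
    fix r assume r: "r \<in> carrier R"
    have "commutator R x r \<otimes> y = x \<otimes> r \<otimes> y \<ominus> r \<otimes> (x \<otimes> y)"
      using x y r unfolding commutator_def by algebra
    \<comment> \<open>The term x r y vanishes by \<open>sandwich\<close>, applied to the product y
      x, which is zero by \<open>swap\<close>.\<close>
    also have "\<dots> = \<zero>"
      using sandwich[of y x r] swap[of x y] xy x y r by simp
    finally show "x \<otimes> r = r \<otimes> x"
      using left[of x r y] x y r commutator_eq_zero_iff by blast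
  qed (rule x)
  obtain a b where ab: "a \<in> carrier R" "b \<in> carrier R" "a \<otimes> b \<noteq> b \<otimes> a"
    by (rule noncommuting_obtains[OF noncomm])
  \<comment> \<open>As \<open>x\<close> is central, x (a, b) is again a commutator, so regularity
    applies to it: it is killed by \<open>y\<close>, hence zero, and then (a, b) is killed by
    \<open>x\<close>.\<close>
  have c: "commutator R (x \<otimes> a) b = x \<otimes> commutator R a b"
  proof -
    have "b \<otimes> (x \<otimes> a) = x \<otimes> (b \<otimes> a)"
      using center_comm[OF \<open>x \<in> center R\<close>, of b] ab x m_assoc[of b x a] m_assoc[of x b a] by simp
    then show ?thesis unfolding commutator_def using ab x by (simp add: m_assoc minus_eq r_distr r_minus)
  qed
  have "y \<otimes> commutator R (x \<otimes> a) b = y \<otimes> x \<otimes> commutator R a b"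
    unfolding c using x y ab by (simp add: m_assoc)
  then have "y \<otimes> commutator R (x \<otimes> a) b = \<zero>" using swap[of x y] x y ab xy by simp
  then have "x \<otimes> commutator R a b = \<zero>"
    using left[of "x \<otimes> a" b y] ab x y c by simp
  then have "commutator R a b = \<zero>" using left[of a b x] ab x by simp
  with ab show False using commutator_eq_zero_iff by blast
qed

end

section \<open>Domains in which commutators have central squares\<close>

text \<open>Collects what the first conclusion and the condition on the characteristic provide. The
  same properties are shown for the localization, so the lemmas apply to both rings.\<close>

locale ring_central_squares = ring R for R (structure) +
  assumes noncomm: "\<not> cring R"
    and integral: "\<And>x y. x \<in> carrier R \<Longrightarrow> y \<in> carrier R \<Longrightarrow> x \<otimes> y = \<zero> \<Longrightarrow> x = \<zero> \<or> y = \<zero>"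
    and two_neq_zero: "\<one> \<oplus> \<one> \<noteq> \<zero>"
    and commutator_square: "\<And>x y. x \<in> carrier R \<Longrightarrow> y \<in> carrier R \<Longrightarrow>
      commutator R x y \<otimes> commutator R x y \<in> center R"
begin

text \<open>f (z x - x z) = (f z) x - x (f z) = 0 because \<open>f\<close> and
  \<open>f \<otimes> z\<close> are central, and the nonzero \<open>f\<close> cancels.\<close>

lemma center_cancel:
  assumes f: "f \<in> center R" "f \<noteq> \<zero>" and z: "z \<in> carrier R" and fz: "f \<otimes> z \<in> center R"
  shows "z \<in> center R"
proof (rule centerI[OF z])
  fix x assume x: "x \<in> carrier R"
  note fc = center_carrier[OF f(1)]
  have "f \<otimes> (x \<otimes> z) = x \<otimes> (f \<otimes> z)"
    using center_comm[OF f(1) x] x z fc m_assoc[of f x z] m_assoc[of x f z] by simp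
  also have "\<dots> = f \<otimes> (z \<otimes> x)" using center_comm[OF fz x] x z fc by (simp add: m_assoc)
  finally have "f \<otimes> (z \<otimes> x \<ominus> x \<otimes> z) = \<zero>"
    using x z fc by (simp add: minus_eq r_distr r_minus r_neg)
  then show "z \<otimes> x = x \<otimes> z" using integral[of f "z \<otimes> x \<ominus> x \<otimes> z"] f fc x z r_right_minus_eq by simp
qed

lemma double_eq_zero:
  assumes "z \<in> carrier R" "z \<oplus> z = \<zero>" shows "z = \<zero>"
  using integral[of "\<one> \<oplus> \<one>" z] two_neq_zero assms l_distr[of \<one> \<one> z] by simp

lemma double_center:
  assumes "z \<in> carrier R" "z \<oplus> z \<in> center R" shows "z \<in> center R"
proof (rule center_cancel[OF _ two_neq_zero])
  show "\<one> \<oplus> \<one> \<in> center R" using center_closed by blast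
  show "(\<one> \<oplus> \<one>) \<otimes> z \<in> center R" using assms l_distr[of \<one> \<one> z] by simp
qed (rule assms)

text \<open>The difference of the two squares is 2 z + 1, so 2 z is central, and 2 cancels.\<close>

lemma center_if_squares_center:
  assumes z: "z \<in> carrier R" and z2: "z \<otimes> z \<in> center R" and "(z \<oplus> \<one>) \<otimes> (z \<oplus> \<one>) \<in> center R"
  shows "z \<in> center R"
proof (rule double_center[OF z])
  have "z \<oplus> z = (z \<oplus> \<one>) \<otimes> (z \<oplus> \<one>) \<oplus> \<ominus> (z \<otimes> z \<oplus> \<one>)"
    using z by (simp add: ring_simprules)
  then show "z \<oplus> z \<in> center R" using assms center_closed by simp
qed

text \<open>This is the source of inverses in the localization: dividing \<open>s\<close> by the
  central element \<open>r \<otimes> s\<close> inverts \<open>r\<close> on both sides.\<close>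

lemma ex_central_multiple:
  assumes r: "r \<in> carrier R" "r \<noteq> \<zero>"
  shows "\<exists>s\<in>carrier R. r \<otimes> s \<in> center R \<and> r \<otimes> s \<noteq> \<zero> \<and> s \<otimes> r = r \<otimes> s"
proof (cases "r \<in> center R")
  case True
  then show ?thesis using r by (intro bexI[of _ \<one>]) auto
next
  case False
  then obtain y where y: "y \<in> carrier R" "commutator R r y \<noteq> \<zero>"
    using not_center_obtains r by blast
  define v where "v = commutator R r y"
  have v: "v \<in> carrier R" "v \<noteq> \<zero>" using y r by (auto simp: v_def)
  \<comment> \<open>(r, r y) = r v has the central square r (v r v); \<open>s\<close> is the
    cofactor of \<open>r\<close>.\<close>
  define s where "s = v \<otimes> (r \<otimes> v)"
  have s: "s \<in> carrier R" "s \<noteq> \<zero>" using v r integral[of v "r \<otimes> v"] integral[of r v] by (auto simp: s_def)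
  have rs: "r \<otimes> s \<in> center R" "r \<otimes> s \<noteq> \<zero>"
    using commutator_square[of r "r \<otimes> y"] commutator_mult_self[of r y] r y v s integral[of r s]
    by (auto simp: s_def v_def[symmetric] m_assoc)
  \<comment> \<open>The right side vanishes because \<open>r \<otimes> s\<close> is central;
    cancelling \<open>r\<close> on the left then shows that \<open>s\<close> and \<open>r\<close>
    commute.\<close>
  have "r \<otimes> (s \<otimes> r \<ominus> r \<otimes> s) = r \<otimes> s \<otimes> r \<ominus> r \<otimes> (r \<otimes> s)"
    using r s by algebra
  also have "\<dots> = \<zero>" using center_comm[OF rs(1) r(1)] r s by simp
  finally have "s \<otimes> r = r \<otimes> s" using integral[of r "s \<otimes> r \<ominus> r \<otimes> s"] r s by simp
  with rs s show ?thesis by blast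
qed

section \<open>Existence of an anticommuting pair with central squares\<close>

lemma ex_anticommuting:
  obtains i j where "i \<in> carrier R" "j \<in> carrier R" "i \<noteq> \<zero>" "j \<noteq> \<zero>"
    "i \<otimes> i \<in> center R" "j \<otimes> j \<in> center R" "i \<otimes> j = \<ominus> (j \<otimes> i)"
proof -
  obtain x y where xy: "x \<in> carrier R" "y \<in> carrier R" "x \<otimes> y \<noteq> y \<otimes> x"
    by (rule noncommuting_obtains[OF noncomm])
  define v where "v = commutator R x y"
  have v: "v \<in> carrier R" "v \<noteq> \<zero>" "v \<otimes> v \<in> center R"
    using xy commutator_eq_zero_iff commutator_square by (auto simp: v_def)
  define i where "i = commutator R x v"
  have i: "i \<in> carrier R" "i \<otimes> i \<in> center R"
    using xy v commutator_square by (auto simp: i_def)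
  \<comment> \<open>Moving the central v^2 to the front of the first term leaves v (v x - x v),
    which is the negative of v i.\<close>
  have "i \<otimes> v = x \<otimes> (v \<otimes> v) \<ominus> v \<otimes> (x \<otimes> v)"
    unfolding i_def commutator_def using xy v(1) by algebra
  also have "\<dots> = v \<otimes> v \<otimes> x \<ominus> v \<otimes> (x \<otimes> v)" using center_comm[OF v(3) xy(1)] by simp
  also have "\<dots> = \<ominus> (v \<otimes> i)" unfolding i_def commutator_def using xy v(1) by algebra
  finally have anti: "i \<otimes> v = \<ominus> (v \<otimes> i)" .
  have "i \<noteq> \<zero>"
  proof
    assume "i = \<zero>"
    then have comm: "x \<otimes> v = v \<otimes> x" using commutator_eq_zero_iff xy v by (simp add: i_def)
    \<comment> \<open>Kept general in \<open>u\<close> to cover both x and x + 1, which have the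
      same commutator \<open>v\<close> with \<open>y\<close>. The square of (u, u y) = u v is v^2
      u^2, and the central v^2 cancels. With both squares central, \<open>x\<close> would be
      central, against the choice of \<open>x\<close> and \<open>y\<close>.\<close>
    have square: "u \<otimes> u \<in> center R"
      if u: "u \<in> carrier R" "commutator R u y = v" "u \<otimes> v = v \<otimes> u" for u
    proof (rule center_cancel[OF v(3)])
      show "v \<otimes> v \<noteq> \<zero>" using v integral by blast
      have "u \<otimes> v \<otimes> (u \<otimes> v) \<in> center R"
        using commutator_square[of u "u \<otimes> y"] commutator_mult_self[of u y] u xy by simp
      also have "u \<otimes> v \<otimes> (u \<otimes> v) = v \<otimes> (u \<otimes> (v \<otimes> u))" using u v by (simp add: m_assoc)
      also have "\<dots> = v \<otimes> (u \<otimes> v \<otimes> u)" using u(1) v(1) by (simp add: m_assoc)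
      also have "\<dots> = v \<otimes> v \<otimes> (u \<otimes> u)" unfolding u(3) using u(1) v(1) by (simp add: m_assoc)
      finally show "v \<otimes> v \<otimes> (u \<otimes> u) \<in> center R" .
    qed (use u in simp)
    have "x \<in> center R"
    proof (rule center_if_squares_center[OF xy(1)])
      show "x \<otimes> x \<in> center R" using square[OF xy(1)] comm v_def by blast
      have "commutator R (x \<oplus> \<one>) y = v" unfolding v_def commutator_def using xy by (simp add: ring_simprules)
      then show "(x \<oplus> \<one>) \<otimes> (x \<oplus> \<one>) \<in> center R"
        using xy v comm by (intro square) (auto simp: l_distr r_distr)
    qed
    with xy center_comm show False by blast
  qed
  then show ?thesis using that[of i v] i v anti by blast
qed

section \<open>Centralizer and linear independence for an anticommuting pair\<close>

context
  fixes i j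
  assumes i: "i \<in> carrier R" "i \<noteq> \<zero>" "i \<otimes> i \<in> center R"
    and j: "j \<in> carrier R" "j \<noteq> \<zero>" "j \<otimes> j \<in> center R"
    and anti: "i \<otimes> j = \<ominus> (j \<otimes> i)"
begin

text \<open>One exchange of \<open>i\<close> and \<open>j\<close> gives (i j)^2 = - i^2 j^2.\<close>

lemma square_prod_center: "i \<otimes> j \<otimes> (i \<otimes> j) \<in> center R"
proof -
  have "i \<otimes> j \<otimes> (i \<otimes> j) = \<ominus> (j \<otimes> i \<otimes> (i \<otimes> j))" using i j anti by (simp add: l_minus)
  also have "\<dots> = \<ominus> (j \<otimes> (i \<otimes> i \<otimes> j))" using i(1) j(1) by (simp add: m_assoc)
  also have "\<dots> = \<ominus> ((i \<otimes> i) \<otimes> (j \<otimes> j))"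
    unfolding center_comm[OF i(3) j(1)] using center_comm[OF i(3), of "j \<otimes> j"] i j by (simp add: m_assoc)
  finally show ?thesis using i j center_closed by simp
qed

text \<open>For u commuting with both elements, (i, u j) = 2 u i j is a commutator, so its square is
  central and yields a central u^2. This holds for z and for z + 1, which suffices.\<close>

lemma centralizer_center:
  assumes z: "z \<in> carrier R" "z \<otimes> i = i \<otimes> z" "z \<otimes> j = j \<otimes> z"
  shows "z \<in> center R"
proof -
  have square: "u \<otimes> u \<in> center R"
    if u: "u \<in> carrier R" "u \<otimes> i = i \<otimes> u" "u \<otimes> j = j \<otimes> u" for u
  proof -
    define k where "k = i \<otimes> j"
    have k: "k \<in> carrier R" "k \<otimes> k \<in> center R" "k \<otimes> k \<noteq> \<zero>"
      using i j square_prod_center integral[of i j] integral[of k k] by (auto simp: k_def)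
    have "u \<otimes> k = i \<otimes> (u \<otimes> j)" using u(1,2) i(1) j(1) by (simp add: k_def flip: m_assoc)
    then have uk: "u \<otimes> k = k \<otimes> u" using u(1,3) i(1) j(1) by (simp add: k_def m_assoc)
    define w where "w = u \<otimes> k"
    have w: "w \<in> carrier R" using u k by (simp add: w_def)
    have "i \<otimes> (u \<otimes> j) = w"
      using u(1) i(1) j(1) u(2)[symmetric] m_assoc[of i u j] m_assoc[of u i j] by (simp add: w_def k_def)
    moreover have "u \<otimes> j \<otimes> i = \<ominus> w"
      using u(1) i(1) j(1) anti r_minus[of u "j \<otimes> i"] minus_minus
      by (simp add: w_def k_def m_assoc)
    ultimately have "commutator R i (u \<otimes> j) = w \<oplus> w"
      using w by (simp add: commutator_def minus_eq)
    \<comment> \<open>This square is 4 w^2; the factor 4 is removed by halving twice.\<close>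
    then have "(w \<oplus> w) \<otimes> (w \<oplus> w) \<in> center R"
      using commutator_square[of i "u \<otimes> j"] i u j by simp
    also have "(w \<oplus> w) \<otimes> (w \<oplus> w) = (w \<otimes> w \<oplus> w \<otimes> w) \<oplus> (w \<otimes> w \<oplus> w \<otimes> w)"
      using w by (simp add: l_distr r_distr)
    finally have "w \<otimes> w \<oplus> w \<otimes> w \<in> center R"
      using w by (intro double_center[of "w \<otimes> w \<oplus> w \<otimes> w"]) simp_all
    then have "w \<otimes> w \<in> center R" using w by (intro double_center[of "w \<otimes> w"]) simp_all
    \<comment> \<open>Since \<open>k\<close> commutes with \<open>u\<close>, the square becomes k^2
      u^2, and the nonzero central k^2 can be cancelled.\<close>
    also have "w \<otimes> w = k \<otimes> u \<otimes> (k \<otimes> u)" by (simp add: w_def uk)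
    also have "\<dots> = k \<otimes> (u \<otimes> k \<otimes> u)" using u(1) k(1) by (simp add: m_assoc)
    also have "\<dots> = k \<otimes> k \<otimes> (u \<otimes> u)" unfolding uk using u(1) k(1) by (simp add: m_assoc)
    finally show ?thesis using center_cancel[OF k(2,3), of "u \<otimes> u"] u by simp
  qed
  show ?thesis
    by (rule center_if_squares_center[OF z(1) square[OF z] square])
      (use z i(1) j(1) in \<open>simp_all add: l_distr r_distr\<close>)
qed

text \<open>Adding the right and left multiples by \<open>j\<close> cancels the term in
  \<open>i\<close> and leaves 2 f j = 0.\<close>

lemma independent_one_i:
  assumes f: "f \<in> center R" "g \<in> center R" and sum: "f \<oplus> g \<otimes> i = \<zero>"
  shows "f = \<zero> \<and> g = \<zero>"
proof -
  note fg = center_carrier[OF f(1)] center_carrier[OF f(2)]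
  have gij: "g \<otimes> (i \<otimes> j) = \<ominus> (j \<otimes> (g \<otimes> i))"
    using anti center_comm[OF f(2), of "j \<otimes> i"] center_comm[OF f(2), of i] i(1) j(1) fg
    by (simp add: r_minus m_assoc)
  have "\<zero> = (f \<oplus> g \<otimes> i) \<otimes> j \<oplus> j \<otimes> (f \<oplus> g \<otimes> i)" using sum j(1) by simp
  also have "\<dots> = f \<otimes> j \<oplus> \<ominus> (j \<otimes> (g \<otimes> i)) \<oplus> (j \<otimes> f \<oplus> j \<otimes> (g \<otimes> i))"
    using fg i(1) j(1) gij by (simp add: l_distr r_distr m_assoc)
  also have "\<dots> = f \<otimes> j \<oplus> j \<otimes> f"
    using add_cancel[of "f \<otimes> j" "j \<otimes> f" "\<ominus> (j \<otimes> (g \<otimes> i))"] fg i(1) j(1) by simp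
  also have "\<dots> = f \<otimes> j \<oplus> f \<otimes> j" using center_comm[OF f(1) j(1)] by simp
  finally have "f \<otimes> j \<oplus> f \<otimes> j = \<zero>" by (rule sym)
  then have "f \<otimes> j = \<zero>" using double_eq_zero[of "f \<otimes> j"] fg j(1) by simp
  then have "f = \<zero>" using integral[of f j] fg j by simp
  moreover from this have "g = \<zero>" using sum fg i integral[of g i] by simp
  ultimately show ?thesis by blast
qed

text \<open>The sum is grouped as p + q j with \<open>p\<close> and \<open>q\<close> commuting with
  \<open>i\<close>. Adding its left and right multiples by \<open>i\<close> cancels the part with
  \<open>j\<close> and leaves 2 i p = 0. Then \<open>p\<close> and \<open>q\<close> both vanish, and
  the case of two elements applies to each.\<close>

lemma independent_one_i_j_ij:
  assumes f: "a \<in> center R" "b \<in> center R" "c \<in> center R" "d \<in> center R"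
    and sum: "a \<oplus> b \<otimes> i \<oplus> (c \<oplus> d \<otimes> i) \<otimes> j = \<zero>"
  shows "a = \<zero> \<and> b = \<zero> \<and> c = \<zero> \<and> d = \<zero>"
proof -
  note fc = f[THEN center_carrier]
  define p q where "p = a \<oplus> b \<otimes> i" and "q = c \<oplus> d \<otimes> i"
  have pq: "p \<in> carrier R" "q \<in> carrier R" "p \<oplus> q \<otimes> j = \<zero>"
    using fc i(1) sum by (auto simp: p_def q_def)
  have comm: "p \<otimes> i = i \<otimes> p" "q \<otimes> i = i \<otimes> q"
    using fc i(1) center_comm[OF f(1) i(1)] center_comm[OF f(2) i(1)] center_comm[OF f(3) i(1)]
      center_comm[OF f(4) i(1)] m_assoc[of i b i] m_assoc[of i d i]
    by (simp_all add: p_def q_def l_distr r_distr)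
  have "\<zero> = i \<otimes> (p \<oplus> q \<otimes> j) \<oplus> (p \<oplus> q \<otimes> j) \<otimes> i" using pq i(1) by simp
  also have "\<dots> = i \<otimes> p \<oplus> i \<otimes> q \<otimes> j \<oplus> (i \<otimes> p \<oplus> q \<otimes> (j \<otimes> i))"
    using pq(1,2) comm(1) i(1) j(1) by (simp add: l_distr r_distr m_assoc)
  also have "q \<otimes> (j \<otimes> i) = \<ominus> (i \<otimes> q \<otimes> j)"
    using anti pq(1,2) i(1) j(1) comm(2)[symmetric] minus_minus[of "j \<otimes> i"] by (simp add: m_assoc r_minus)
  also have "i \<otimes> p \<oplus> i \<otimes> q \<otimes> j \<oplus> (i \<otimes> p \<oplus> \<ominus> (i \<otimes> q \<otimes> j)) = i \<otimes> p \<oplus> i \<otimes> p"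
    using add_cancel[of "i \<otimes> p" "i \<otimes> p" "i \<otimes> q \<otimes> j"] pq(1,2) i(1) j(1) by simp
  finally have "i \<otimes> p \<oplus> i \<otimes> p = \<zero>" by (rule sym)
  then have "i \<otimes> p = \<zero>" using double_eq_zero[of "i \<otimes> p"] pq(1) i(1) by simp
  then have p0: "p = \<zero>" using integral[of i p] i pq by blast
  with pq j(1) have "q \<otimes> j = \<zero>" by simp
  then have "q = \<zero>" using integral[of q j] pq(2) j(1,2) by blast
  with p0 show ?thesis
    using independent_one_i[OF f(1,2)] independent_one_i[OF f(3,4)] unfolding p_def q_def by blast
qed

end

end

section \<open>Division rings: the quaternion basis over the center\<close>

locale division_ring_central_squares = ring_central_squares +
  assumes division: "division_ring R"
begin

lemma center_inverse:
  assumes "f \<in> center R" "f \<noteq> \<zero>"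
  obtains g where "g \<in> center R" "g \<otimes> f = \<one>" "f \<otimes> g = \<one>"
proof -
  have "f \<in> Units R" using assms division center_carrier by (auto simp: division_ring_def)
  then obtain g where g: "g \<in> carrier R" "g \<otimes> f = \<one>" "f \<otimes> g = \<one>" by (auto simp: Units_def)
  then have "g \<in> center R"
    using center_cancel[OF assms, of g] center_closed(2) by simp
  with g that show ?thesis by blast
qed

lemma center_subfield: "subfield (center R) R"
proof (rule subfieldI[OF center_subcring], intro subset_antisym subsetI)
  have 1: "\<one> \<noteq> \<zero>" using two_neq_zero l_zero by force
  fix f assume "f \<in> Units (R\<lparr>carrier := center R\<rparr>)"
  then have "f \<in> center R \<and> (\<exists>g\<in>center R. g \<otimes> f = \<one>)" by (auto simp: Units_def)
  moreover from this 1 have "f \<noteq> \<zero>" using center_carrier r_null by metis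
  ultimately show "f \<in> center R - {\<zero>}" by blast
next
  fix f assume "f \<in> center R - {\<zero>}"
  then show "f \<in> Units (R\<lparr>carrier := center R\<rparr>)"
    using center_inverse[of f] by (auto simp: Units_def)
qed

text \<open>With \<open>g\<close> inverse to u^2, w = g u (u w) = g (u w) u, and the coefficient g
  (u w) is central.\<close>

lemma central_scalar_if_mult_center:
  assumes u: "u \<in> carrier R" "u \<noteq> \<zero>" "u \<otimes> u \<in> center R"
    and w: "w \<in> carrier R" "u \<otimes> w \<in> center R"
  shows "\<exists>f\<in>center R. w = f \<otimes> u"
proof -
  have "u \<otimes> u \<noteq> \<zero>" using u integral by blast
  then obtain g where g: "g \<in> center R" "g \<otimes> (u \<otimes> u) = \<one>" using center_inverse u by blast
  note gc = center_carrier[OF g(1)]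
  have "w = g \<otimes> (u \<otimes> u) \<otimes> w" using g w by simp
  also have "\<dots> = g \<otimes> (u \<otimes> (u \<otimes> w))" using gc u w by (simp add: m_assoc)
  also have "\<dots> = g \<otimes> (u \<otimes> w) \<otimes> u"
    using center_comm[OF w(2) u(1)] gc u w by (simp add: m_assoc)
  finally show ?thesis using center_closed(4)[OF g(1) w(2)] by blast
qed

text \<open>Decomposition into the eigenspaces of conjugation by \<open>u\<close>, an involution as \<open>u\<^sup>2\<close> is central.\<close>

lemma commuting_anticommuting_decomposition:
  assumes u: "u \<in> carrier R" "u \<noteq> \<zero>" "u \<otimes> u \<in> center R" and r: "r \<in> carrier R"
  obtains h where "h \<in> center R"
    "r = h \<otimes> (u \<otimes> u \<otimes> r \<oplus> u \<otimes> r \<otimes> u) \<oplus> h \<otimes> (u \<otimes> u \<otimes> r \<ominus> u \<otimes> r \<otimes> u)"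
    "(u \<otimes> u \<otimes> r \<oplus> u \<otimes> r \<otimes> u) \<otimes> u = u \<otimes> (u \<otimes> u \<otimes> r \<oplus> u \<otimes> r \<otimes> u)"
    "(u \<otimes> u \<otimes> r \<ominus> u \<otimes> r \<otimes> u) \<otimes> u = \<ominus> (u \<otimes> (u \<otimes> u \<otimes> r \<ominus> u \<otimes> r \<otimes> u))"
proof -
  define a where "a = u \<otimes> u"
  have a: "a \<in> carrier R" "a \<in> center R" "a \<noteq> \<zero>" using u integral by (auto simp: a_def)
  have "a \<oplus> a \<noteq> \<zero>" "a \<oplus> a \<in> center R" using a double_eq_zero center_closed by blast+
  \<comment> \<open>\<open>h\<close> inverts 2 u^2, the factor picked up when the two unnormalized
    components are added.\<close>
  then obtain h where h: "h \<in> center R" "h \<otimes> (a \<oplus> a) = \<one>" using center_inverse by blast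
  note hc = center_carrier[OF h(1)]
  have "h \<otimes> (a \<otimes> r \<oplus> u \<otimes> r \<otimes> u) \<oplus> h \<otimes> (a \<otimes> r \<ominus> u \<otimes> r \<otimes> u) = h \<otimes> (a \<oplus> a) \<otimes> r"
    using hc a u(1) r by algebra
  then have 1: "r = h \<otimes> (a \<otimes> r \<oplus> u \<otimes> r \<otimes> u) \<oplus> h \<otimes> (a \<otimes> r \<ominus> u \<otimes> r \<otimes> u)" using h r by simp
  have au: "a \<otimes> u = u \<otimes> a" using u by (simp add: a_def m_assoc)
  \<comment> \<open>Passing \<open>u\<close> from right to left interchanges u^2 r and u r u. Hence
    their sum commutes with \<open>u\<close> and their difference anticommutes.\<close>
  have ar: "u \<otimes> r \<otimes> u \<otimes> u = u \<otimes> (a \<otimes> r)"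
    using center_comm[OF a(2) r] u(1) r by (simp add: a_def m_assoc)
  have aru: "a \<otimes> r \<otimes> u = u \<otimes> (u \<otimes> r \<otimes> u)" using u r by (simp add: a_def m_assoc)
  have 2: "(a \<otimes> r \<oplus> u \<otimes> r \<otimes> u) \<otimes> u = u \<otimes> (a \<otimes> r \<oplus> u \<otimes> r \<otimes> u)"
    using a u(1) r ar aru by (simp only: l_distr r_distr a_comm m_closed)
  have 3: "(a \<otimes> r \<ominus> u \<otimes> r \<otimes> u) \<otimes> u = \<ominus> (u \<otimes> (a \<otimes> r \<ominus> u \<otimes> r \<otimes> u))"
    using a(1) u(1) r ar aru
    by (simp only: l_distr r_distr m_closed minus_eq a_inv_closed l_minus r_minus minus_add minus_minus a_comm)
  show thesis using that[OF h(1)] 1 2 3 unfolding a_def by blast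
qed

text \<open>Splitting \<open>r\<close> by conjugation with \<open>j\<close> gives parts
  \<open>p\<close> and \<open>q\<close> that still commute with \<open>i\<close>. Then
  \<open>p\<close> commutes with both \<open>i\<close> and \<open>j\<close>, and so does
  \<open>i \<otimes> q\<close>, its two signs cancelling. Both are central, which makes
  \<open>q\<close> a central multiple of \<open>i\<close>.\<close>

lemma commuting_span:
  assumes i: "i \<in> carrier R" "i \<noteq> \<zero>" "i \<otimes> i \<in> center R"
    and j: "j \<in> carrier R" "j \<noteq> \<zero>" "j \<otimes> j \<in> center R"
    and anti: "i \<otimes> j = \<ominus> (j \<otimes> i)"
    and r: "r \<in> carrier R" "r \<otimes> i = i \<otimes> r"
  shows "\<exists>f\<in>center R. \<exists>g\<in>center R. r = f \<oplus> g \<otimes> i"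
proof -
  define p q where "p = j \<otimes> j \<otimes> r \<oplus> j \<otimes> r \<otimes> j" and "q = j \<otimes> j \<otimes> r \<ominus> j \<otimes> r \<otimes> j"
  obtain h where h: "h \<in> center R" "r = h \<otimes> p \<oplus> h \<otimes> q"
    and pj: "p \<otimes> j = j \<otimes> p" and qj: "q \<otimes> j = \<ominus> (j \<otimes> q)"
    by (rule commuting_anticommuting_decomposition[OF j r(1), folded p_def q_def])
  have pq: "p \<in> carrier R" "q \<in> carrier R" using j r by (auto simp: p_def q_def)
  \<comment> \<open>Moving \<open>i\<close> across two factors \<open>j\<close> changes the sign
    twice.\<close>
  have "j \<otimes> r \<otimes> j \<otimes> i = i \<otimes> (j \<otimes> r \<otimes> j)"
  proof -
    have "i \<otimes> (j \<otimes> r \<otimes> j) = \<ominus> (j \<otimes> (i \<otimes> r) \<otimes> j)"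
      using anticommuting_mult[OF i(1) j(1) anti, of "r \<otimes> j"] i(1) j(1) r(1) by (simp add: m_assoc)
    also have "\<dots> = \<ominus> (j \<otimes> r \<otimes> (i \<otimes> j))" using i(1) j(1) r(1) r(2)[symmetric] by (simp add: m_assoc)
    finally show ?thesis using anti i(1) j(1) r(1) by (simp add: m_assoc r_minus)
  qed
  moreover have "j \<otimes> j \<otimes> r \<otimes> i = i \<otimes> (j \<otimes> j \<otimes> r)"
  proof -
    have "j \<otimes> j \<otimes> r \<otimes> i = j \<otimes> j \<otimes> i \<otimes> r" using i(1) j(1) r by (simp add: m_assoc)
    also have "\<dots> = i \<otimes> (j \<otimes> j \<otimes> r)"
      using center_comm[OF j(3) i(1)] i(1) j(1) r(1) by (simp add: m_assoc)
    finally show ?thesis .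
  qed
  ultimately have pi: "p \<otimes> i = i \<otimes> p" and qi: "q \<otimes> i = i \<otimes> q"
    using i(1) j(1) r(1) by (simp_all only: p_def q_def minus_eq l_distr r_distr l_minus r_minus m_closed a_inv_closed)
  have "p \<in> center R"
    using centralizer_center[OF i j anti pq(1) pi pj] .
  moreover have "i \<otimes> q \<in> center R"
  proof (rule centralizer_center[OF i j anti])
    show "i \<otimes> q \<otimes> i = i \<otimes> (i \<otimes> q)" using qi i(1) pq by (simp add: m_assoc)
    have "j \<otimes> (i \<otimes> q) = \<ominus> (i \<otimes> (j \<otimes> q))"
      using anticommuting_mult[OF i(1) j(1) anti pq(2)] i j pq by simp
    then show "i \<otimes> q \<otimes> j = j \<otimes> (i \<otimes> q)" using qj i(1) j(1) pq by (simp add: m_assoc r_minus)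
  qed (use i pq in simp)
  then obtain f where f: "f \<in> center R" "q = f \<otimes> i" using central_scalar_if_mult_center[OF i pq(2)] by blast
  moreover have "r = h \<otimes> p \<oplus> (h \<otimes> f) \<otimes> i"
    using h(2) unfolding f(2) using center_carrier[OF h(1)] center_carrier[OF f(1)] i(1) by (simp add: m_assoc)
  ultimately show ?thesis using center_closed(4)[OF h(1)] by blast
qed

text \<open>Conjugation by \<open>i\<close> splits \<open>r\<close> into a commuting and an
  anticommuting part. The latter, divided by \<open>j\<close> on the right, commutes with
  \<open>i\<close> too, so \<open>commuting_span\<close> expresses both.\<close>

lemma span_one_i_j_ij:
  assumes i: "i \<in> carrier R" "i \<noteq> \<zero>" "i \<otimes> i \<in> center R"
    and j: "j \<in> carrier R" "j \<noteq> \<zero>" "j \<otimes> j \<in> center R"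
    and anti: "i \<otimes> j = \<ominus> (j \<otimes> i)"
    and r: "r \<in> carrier R"
  shows "\<exists>a\<in>center R. \<exists>b\<in>center R. \<exists>c\<in>center R. \<exists>d\<in>center R.
    r = a \<oplus> b \<otimes> i \<oplus> (c \<oplus> d \<otimes> i) \<otimes> j"
proof -
  define p q where "p = i \<otimes> i \<otimes> r \<oplus> i \<otimes> r \<otimes> i" and "q = i \<otimes> i \<otimes> r \<ominus> i \<otimes> r \<otimes> i"
  obtain h where h: "h \<in> center R" "r = h \<otimes> p \<oplus> h \<otimes> q"
    and pi: "p \<otimes> i = i \<otimes> p" and qi: "q \<otimes> i = \<ominus> (i \<otimes> q)"
    by (rule commuting_anticommuting_decomposition[OF i r, folded p_def q_def])
  have pq: "p \<in> carrier R" "q \<in> carrier R" using i r by (auto simp: p_def q_def)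
  note hc = center_carrier[OF h(1)]
  have hi: "h \<otimes> i = i \<otimes> h" using center_comm[OF h(1) i(1)] .
  have j2: "j \<otimes> j \<noteq> \<zero>" using j integral by blast
  obtain g where g: "g \<in> center R" "g \<otimes> (j \<otimes> j) = \<one>" "j \<otimes> j \<otimes> g = \<one>" using center_inverse[OF j(3) j2] by blast
  note gc = center_carrier[OF g(1)]
  \<comment> \<open>As \<open>g\<close> inverts j^2, the factor \<open>g \<otimes> j\<close> is the
    inverse of \<open>j\<close>. Both factors of \<open>s\<close> anticommute with \<open>i\<close>,
    so \<open>s\<close> commutes with it.\<close>
  define s where "s = h \<otimes> q \<otimes> (g \<otimes> j)"
  have s: "s \<in> carrier R" using hc gc pq j by (simp add: s_def)
  have sj: "s \<otimes> j = h \<otimes> q" using hc gc pq j g by (simp add: s_def m_assoc)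
  have "g \<otimes> j \<otimes> i = \<ominus> (i \<otimes> (g \<otimes> j))"
  proof -
    have "i \<otimes> (g \<otimes> j) = g \<otimes> (i \<otimes> j)"
      using center_comm[OF g(1) i(1)] m_assoc[of i g j] m_assoc[of g i j] gc i(1) j(1) by simp
    then show ?thesis using anti gc i(1) j(1) by (simp add: m_assoc r_minus)
  qed
  moreover have "h \<otimes> q \<otimes> i = \<ominus> (i \<otimes> (h \<otimes> q))"
    using hi qi hc pq(2) i(1) m_assoc[of i h q] m_assoc[of h i q] m_assoc[of h q i] by (simp add: r_minus)
  ultimately have "s \<otimes> i = i \<otimes> s"
    unfolding s_def
    by (intro anticommuting_prod_commutes) (use hc gc pq(2) i(1) j(1) in simp_all)
  moreover have "h \<otimes> p \<otimes> i = i \<otimes> (h \<otimes> p)"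
    using hi pi hc pq(1) i(1) m_assoc[of i h p] m_assoc[of h i p] m_assoc[of h p i] by simp
  moreover have "r = h \<otimes> p \<oplus> s \<otimes> j" using h sj by simp
  ultimately show ?thesis
    using commuting_span[OF i j anti, of s] commuting_span[OF i j anti, of "h \<otimes> p"] s hc pq by fastforce
qed

lemma ring_char_center: "ring_char (R\<lparr>carrier := center R\<rparr>) \<noteq> 2"
proof
  interpret C: ring "R\<lparr>carrier := center R\<rparr>"
    using subring_is_ring[OF subcring.axioms(1)[OF center_subcring]] .
  assume "ring_char (R\<lparr>carrier := center R\<rparr>) = 2"
  then have "add_pow (R\<lparr>carrier := center R\<rparr>) (2::nat) \<one>\<^bsub>R\<lparr>carrier := center R\<rparr>\<^esub> =
      \<zero>\<^bsub>R\<lparr>carrier := center R\<rparr>\<^esub>"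
    unfolding ring_char_def using C.add.pow_ord_eq_1[OF C.one_closed] by argo
  then show False
    using two_neq_zero center_closed(2) by (simp add: numeral_2_eq_2)
qed

theorem quaternion_division_algebra_center: "quaternion_division_algebra (center R) R"
proof -
  obtain i j where i: "i \<in> carrier R" "i \<noteq> \<zero>" "i \<otimes> i \<in> center R"
    and j: "j \<in> carrier R" "j \<noteq> \<zero>" "j \<otimes> j \<in> center R"
    and anti: "i \<otimes> j = \<ominus> (j \<otimes> i)"
    using ex_anticommuting by blast
  let ?B = "[\<one>, i, j, i \<otimes> j]"
  have B: "set ?B \<subseteq> carrier R" using i j by simp
  \<comment> \<open>Regroups the linear combination into the form in which independence and spanning
    were proved.\<close>
  have combine: "combine [a, b, c, d] ?B = a \<oplus> b \<otimes> i \<oplus> (c \<oplus> d \<otimes> i) \<otimes> j"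
    if "a \<in> center R" "b \<in> center R" "c \<in> center R" "d \<in> center R" for a b c d
    using that[THEN center_carrier] i(1) j(1) by (simp add: l_distr m_assoc a_assoc)
  have length: "\<exists>a b c d. Ks = [a, b, c, d]" if "length Ks = 4" for Ks :: "'a list"
    using that by (auto simp: numeral_eq_Suc length_Suc_conv)
  have "independent (center R) ?B"
  proof (rule ccontr)
    assume "dependent (center R) ?B"
    then obtain Ks where Ks: "length Ks = length ?B" "combine Ks ?B = \<zero>" "set Ks \<subseteq> center R" "set Ks \<noteq> {\<zero>}"
      using dependent_imp_non_trivial_combine[OF center_subfield B] by blast
    then obtain a b c d where Ks': "Ks = [a, b, c, d]" using length[of Ks] by auto
    have "a = \<zero> \<and> b = \<zero> \<and> c = \<zero> \<and> d = \<zero>"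
      using independent_one_i_j_ij[OF i j anti, of a b c d] combine[of a b c d] Ks(2,3) unfolding Ks' by auto
    with Ks(4) show False unfolding Ks' by simp
  qed
  moreover have "Span (center R) ?B = carrier R"
  proof (intro subset_antisym subsetI)
    show "r \<in> carrier R" if "r \<in> Span (center R) ?B" for r
      using Span_in_carrier[OF _ B, of "center R"] that center_carrier by blast
    fix r assume "r \<in> carrier R"
    from span_one_i_j_ij[OF i j anti this] obtain a b c d
      where "a \<in> center R" "b \<in> center R" "c \<in> center R" "d \<in> center R" "r = combine [a, b, c, d] ?B"
      using combine by metis
    then have "r = combine [a, b, c, d] ?B \<and> set [a, b, c, d] \<subseteq> center R" by simp
    then show "r \<in> Span (center R) ?B"
      unfolding Span_eq_combine_set[OF center_subfield B] by blast
  qed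
  ultimately show ?thesis
    unfolding quaternion_division_algebra_def
    using division center_subfield ring_char_center i j anti m_closed by blast
qed

end

section \<open>Rings of central fractions\<close>

context central_denominators
begin

abbreviation frac :: "'a \<Rightarrow> 'a \<Rightarrow> ('a \<times> 'a) set"
  where "frac \<equiv> ring_frac R S"

lemma one_denominator: "\<one> \<in> S - {\<zero>}"
  using subringE(3)[OF S_subring] one_neq_zero by blast

lemma frac_closed:
  "x \<in> carrier R \<Longrightarrow> c \<in> S - {\<zero>} \<Longrightarrow> frac x c \<in> carrier (fractions R S)"
  by (auto simp: fractions_def frac_pairs_def ring_frac_def intro!: quotientI)

lemma frac_cases:
  assumes "X \<in> carrier (fractions R S)"
  obtains x c where "x \<in> carrier R" "c \<in> S - {\<zero>}" "X = frac x c"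
  using assms by (auto simp: fractions_def frac_pairs_def ring_frac_def elim!: quotientE)

lemma frac_expand:
  assumes "x \<in> carrier R" "c \<in> S - {\<zero>}" "d \<in> S - {\<zero>}"
  shows "frac (d \<otimes> x) (d \<otimes> c) = frac x c" "frac (d \<otimes> x) (c \<otimes> d) = frac x c"
proof -
  have cd: "c \<in> carrier R" "d \<in> carrier R" "c \<otimes> d = d \<otimes> c"
    using assms S_carrier S_comm[of d c] by auto
  show "frac (d \<otimes> x) (d \<otimes> c) = frac x c"
    using assms cd S_mult[of d c] S_comm[of d c]
    by (subst frac_eq_iff) (auto simp flip: m_assoc)
  then show "frac (d \<otimes> x) (c \<otimes> d) = frac x c" using cd by simp
qed

text \<open>The common denominator is the product of the three given ones. It reduces the ring
  axioms for fractions to those for numerators.\<close>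

lemma frac_cases3:
  assumes "X \<in> carrier (fractions R S)" "Y \<in> carrier (fractions R S)" "Z \<in> carrier (fractions R S)"
  obtains x y z c where "x \<in> carrier R" "y \<in> carrier R" "z \<in> carrier R" "c \<in> S - {\<zero>}"
    "X = frac x c" "Y = frac y c" "Z = frac z c"
proof -
  obtain x c y d z e where
    x: "x \<in> carrier R" "c \<in> S - {\<zero>}" "X = frac x c" and
    y: "y \<in> carrier R" "d \<in> S - {\<zero>}" "Y = frac y d" and
    z: "z \<in> carrier R" "e \<in> S - {\<zero>}" "Z = frac z e"
    using assms by (elim frac_cases)
  have cl: "c \<in> carrier R" "d \<in> carrier R" "e \<in> carrier R" using x y z S_carrier by auto
  have m: "d \<otimes> e \<in> S - {\<zero>}" "c \<otimes> e \<in> S - {\<zero>}" "c \<otimes> d \<in> S - {\<zero>}"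
    using S_mult x y z by auto
  have dc: "d \<otimes> (c \<otimes> e) = c \<otimes> (d \<otimes> e)" using S_lcomm[of c d e] x cl by simp
  have "Y = frac (c \<otimes> e \<otimes> y) (c \<otimes> (d \<otimes> e))"
    using frac_expand(2)[of y d "c \<otimes> e"] y m by (simp add: dc)
  moreover have "X = frac (d \<otimes> e \<otimes> x) (c \<otimes> (d \<otimes> e))"
    using frac_expand(2)[of x c "d \<otimes> e"] x m by simp
  moreover have "Z = frac (c \<otimes> d \<otimes> z) (c \<otimes> (d \<otimes> e))"
    using frac_expand(1)[of z e "c \<otimes> d"] z m cl by (simp add: m_assoc)
  moreover have "c \<otimes> (d \<otimes> e) \<in> S - {\<zero>}" using S_mult x m by simp
  ultimately show thesis using x(1) y(1) z(1) cl
    by (intro that[of "d \<otimes> e \<otimes> x" "c \<otimes> e \<otimes> y" "c \<otimes> d \<otimes> z" "c \<otimes> (d \<otimes> e)"]) simp_all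
qed

lemma frac_cases2:
  assumes "X \<in> carrier (fractions R S)" "Y \<in> carrier (fractions R S)"
  obtains x y c where "x \<in> carrier R" "y \<in> carrier R" "c \<in> S - {\<zero>}" "X = frac x c" "Y = frac y c"
  using that by (rule frac_cases3[OF assms assms(2)])

lemma frac_add_same:
  assumes "x \<in> carrier R" "y \<in> carrier R" "c \<in> S - {\<zero>}"
  shows "frac x c \<oplus>\<^bsub>fractions R S\<^esub> frac y c = frac (x \<oplus> y) c"
  using frac_add[of x c y c] frac_expand(1)[of "x \<oplus> y" c c] assms S_carrier[of c]
  by (simp add: r_distr)

lemma zero_eq_frac: "c \<in> S - {\<zero>} \<Longrightarrow> \<zero>\<^bsub>fractions R S\<^esub> = frac \<zero> c"
  using frac_eq_iff[of \<zero> \<one> \<zero> c] one_denominator S_carrier[of c] by (simp add: fractions_def)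

lemma one_eq_frac: "c \<in> S - {\<zero>} \<Longrightarrow> \<one>\<^bsub>fractions R S\<^esub> = frac c c"
  using frac_eq_iff[of \<one> \<one> c c] one_denominator S_carrier[of c] by (simp add: fractions_def)

lemma one_frac: "\<one>\<^bsub>fractions R S\<^esub> = frac \<one> \<one>"
  by (simp add: fractions_def)

lemma frac_eq_zero_iff:
  "x \<in> carrier R \<Longrightarrow> c \<in> S - {\<zero>} \<Longrightarrow> frac x c = \<zero>\<^bsub>fractions R S\<^esub> \<longleftrightarrow> x = \<zero>"
  using zero_eq_frac[of c] frac_eq_iff[of x c \<zero> c] integral[of c x] S_carrier[of c] by auto

lemma ring_fractions: "ring (fractions R S)"
proof (rule ringI)
  show "abelian_group (fractions R S)"
  proof (rule abelian_groupI)
    fix X Y Z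
    assume XYZ: "X \<in> carrier (fractions R S)" "Y \<in> carrier (fractions R S)" "Z \<in> carrier (fractions R S)"
    then obtain x y z c where f: "x \<in> carrier R" "y \<in> carrier R" "z \<in> carrier R" "c \<in> S - {\<zero>}"
      "X = frac x c" "Y = frac y c" "Z = frac z c"
      by (rule frac_cases3)
    show "X \<oplus>\<^bsub>fractions R S\<^esub> Y \<oplus>\<^bsub>fractions R S\<^esub> Z =
        X \<oplus>\<^bsub>fractions R S\<^esub> (Y \<oplus>\<^bsub>fractions R S\<^esub> Z)"
      using f(1-4) unfolding f(5-7) by (simp add: frac_add_same a_assoc)
  next
    fix X Y
    assume XY: "X \<in> carrier (fractions R S)" "Y \<in> carrier (fractions R S)"
    then obtain x y c where f: "x \<in> carrier R" "y \<in> carrier R" "c \<in> S - {\<zero>}"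
      "X = frac x c" "Y = frac y c"
      by (rule frac_cases2)
    show "X \<oplus>\<^bsub>fractions R S\<^esub> Y \<in> carrier (fractions R S)"
      using f(1-3) unfolding f(4-5) by (simp add: frac_add_same frac_closed)
    show "X \<oplus>\<^bsub>fractions R S\<^esub> Y = Y \<oplus>\<^bsub>fractions R S\<^esub> X"
      using f(1-3) unfolding f(4-5) by (simp add: frac_add_same a_comm)
  next
    fix X assume "X \<in> carrier (fractions R S)"
    then obtain x c where f: "x \<in> carrier R" "c \<in> S - {\<zero>}" "X = frac x c"
      by (rule frac_cases)
    show "\<zero>\<^bsub>fractions R S\<^esub> \<oplus>\<^bsub>fractions R S\<^esub> X = X"
      using f by (simp add: zero_eq_frac[OF f(2)] frac_add_same)
    show "\<exists>Y\<in>carrier (fractions R S). Y \<oplus>\<^bsub>fractions R S\<^esub> X = \<zero>\<^bsub>fractions R S\<^esub>"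
      using f by (intro bexI[of _ "frac (\<ominus> x) c"])
        (simp_all add: zero_eq_frac[OF f(2)] frac_add_same l_neg frac_closed)
  next
    show "\<zero>\<^bsub>fractions R S\<^esub> \<in> carrier (fractions R S)"
      using zero_eq_frac[OF one_denominator] frac_closed[OF zero_closed one_denominator] by simp
  qed
  show "monoid (fractions R S)"
  proof (rule monoidI)
    fix X Y Z
    assume XYZ: "X \<in> carrier (fractions R S)" "Y \<in> carrier (fractions R S)" "Z \<in> carrier (fractions R S)"
    then obtain x y z c where f: "x \<in> carrier R" "y \<in> carrier R" "z \<in> carrier R" "c \<in> S - {\<zero>}"
      "X = frac x c" "Y = frac y c" "Z = frac z c"
      by (rule frac_cases3)
    show "X \<otimes>\<^bsub>fractions R S\<^esub> Y \<otimes>\<^bsub>fractions R S\<^esub> Z =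
        X \<otimes>\<^bsub>fractions R S\<^esub> (Y \<otimes>\<^bsub>fractions R S\<^esub> Z)"
      using f(1-4) S_carrier[of c] S_mult[OF f(4,4)] unfolding f(5-7) by (simp add: frac_mult m_assoc)
    show "X \<otimes>\<^bsub>fractions R S\<^esub> Y \<in> carrier (fractions R S)"
      using f(1-4) S_mult[OF f(4,4)] unfolding f(5-7) by (simp add: frac_mult frac_closed)
  next
    fix X assume "X \<in> carrier (fractions R S)"
    then obtain x c where f: "x \<in> carrier R" "c \<in> S - {\<zero>}" "X = frac x c"
      by (rule frac_cases)
    show "\<one>\<^bsub>fractions R S\<^esub> \<otimes>\<^bsub>fractions R S\<^esub> X = X" "X \<otimes>\<^bsub>fractions R S\<^esub> \<one>\<^bsub>fractions R S\<^esub> = X"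
      using f one_denominator S_carrier[of c] by (simp_all add: one_frac frac_mult)
  next
    show "\<one>\<^bsub>fractions R S\<^esub> \<in> carrier (fractions R S)"
      using frac_closed[OF one_closed one_denominator] by (simp add: one_frac)
  qed
  fix X Y Z
  assume XYZ: "X \<in> carrier (fractions R S)" "Y \<in> carrier (fractions R S)" "Z \<in> carrier (fractions R S)"
  then obtain x y z c where f: "x \<in> carrier R" "y \<in> carrier R" "z \<in> carrier R" "c \<in> S - {\<zero>}"
    "X = frac x c" "Y = frac y c" "Z = frac z c"
    by (rule frac_cases3)
  show "(X \<oplus>\<^bsub>fractions R S\<^esub> Y) \<otimes>\<^bsub>fractions R S\<^esub> Z =
      X \<otimes>\<^bsub>fractions R S\<^esub> Z \<oplus>\<^bsub>fractions R S\<^esub> Y \<otimes>\<^bsub>fractions R S\<^esub> Z"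
    "Z \<otimes>\<^bsub>fractions R S\<^esub> (X \<oplus>\<^bsub>fractions R S\<^esub> Y) =
      Z \<otimes>\<^bsub>fractions R S\<^esub> X \<oplus>\<^bsub>fractions R S\<^esub> Z \<otimes>\<^bsub>fractions R S\<^esub> Y"
    using f(1-4) S_mult[OF f(4,4)] unfolding f(5-7)
    by (simp_all add: frac_add_same frac_mult l_distr r_distr)
qed

sublocale L: ring "fractions R S" by (rule ring_fractions)

lemma frac_minus_same:
  assumes "x \<in> carrier R" "y \<in> carrier R" "c \<in> S - {\<zero>}"
  shows "frac x c \<ominus>\<^bsub>fractions R S\<^esub> frac y c = frac (x \<ominus> y) c"
proof -
  have "\<ominus>\<^bsub>fractions R S\<^esub> frac y c = frac (\<ominus> y) c"
    using assms by (intro L.minus_equality)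
      (simp_all add: frac_closed frac_add_same l_neg zero_eq_frac[OF assms(3)])
  then show ?thesis using assms by (simp add: L.minus_eq minus_eq frac_add_same)
qed

text \<open>Central denominators pull out of commutators; this carries the condition on their
  squares over to fractions.\<close>

lemma frac_commutator:
  assumes "x \<in> carrier R" "y \<in> carrier R" "c \<in> S - {\<zero>}"
  shows "commutator (fractions R S) (frac x c) (frac y c) = frac (commutator R x y) (c \<otimes> c)"
  using assms S_mult[OF assms(3,3)] by (simp add: commutator_def frac_mult frac_minus_same)

text \<open>Commuting with y / 1 gives c (x y) = c (y x), and \<open>c\<close> cancels; conversely,
  central numerators and denominators commute with everything.\<close>

lemma frac_center_iff:
  assumes x: "x \<in> carrier R" and c: "c \<in> S - {\<zero>}"
  shows "frac x c \<in> center (fractions R S) \<longleftrightarrow> x \<in> center R"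
proof
  assume l: "frac x c \<in> center (fractions R S)"
  show "x \<in> center R"
  proof (rule centerI[OF x])
    fix y assume y: "y \<in> carrier R"
    have "frac x c \<otimes>\<^bsub>fractions R S\<^esub> frac y \<one> = frac y \<one> \<otimes>\<^bsub>fractions R S\<^esub> frac x c"
      using L.center_comm[OF l] frac_closed[OF y one_denominator] by simp
    then have "frac (x \<otimes> y) c = frac (y \<otimes> x) c"
      using x y c one_denominator S_carrier[of c] by (simp add: frac_mult)
    then have "c \<otimes> (x \<otimes> y) = c \<otimes> (y \<otimes> x)" using x y c by (simp add: frac_eq_iff)
    then show "x \<otimes> y = y \<otimes> x" using cancel[of c] x y c S_carrier[of c] by simp
  qed
next
  assume r: "x \<in> center R"
  show "frac x c \<in> center (fractions R S)"
  proof (rule L.centerI[OF frac_closed[OF x c]])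
    fix Y assume "Y \<in> carrier (fractions R S)"
    then obtain y d where y: "y \<in> carrier R" "d \<in> S - {\<zero>}" "Y = frac y d" by (rule frac_cases)
    then show "frac x c \<otimes>\<^bsub>fractions R S\<^esub> Y = Y \<otimes>\<^bsub>fractions R S\<^esub> frac x c"
      using x c center_comm[OF r] S_comm[of d c] S_carrier[of c] by (simp add: frac_mult)
  qed
qed

end

section \<open>Localization at the center\<close>

context ring_central_squares
begin

sublocale Loc: central_denominators R "center R"
proof (intro central_denominators.intro central_denominators_axioms.intro ring_axioms)
  show "subring (center R) R" using subcring.axioms(1)[OF center_subcring] .
  show "\<not> zero_divisor R x" for x using integral by (auto simp: zero_divisor_def)
  show "\<one> \<noteq> \<zero>" using two_neq_zero l_zero by force
qed (use center_carrier in auto)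

text \<open>Makes the calculus of fractions available for \<open>center_fraction_field R\<close>,
  where numerators are central as well.\<close>

lemma center_integral_domain: "central_denominators (R\<lparr>carrier := center R\<rparr>) (center R)"
proof -
  interpret C: ring "R\<lparr>carrier := center R\<rparr>"
    using subring_is_ring[OF subcring.axioms(1)[OF center_subcring]] .
  show ?thesis
  proof (intro central_denominators.intro central_denominators_axioms.intro C.ring_axioms)
    show "\<not> zero_divisor (R\<lparr>carrier := center R\<rparr>) x" for x
      using integral center_carrier by (auto simp: zero_divisor_def)
    show "\<one>\<^bsub>R\<lparr>carrier := center R\<rparr>\<^esub> \<noteq> \<zero>\<^bsub>R\<lparr>carrier := center R\<rparr>\<^esub>"
      using Loc.one_neq_zero by simp
    show "center R \<subseteq> center (R\<lparr>carrier := center R\<rparr>)"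
      by (auto simp: center_def)
    show "subring (center R) (R\<lparr>carrier := center R\<rparr>)" using C.carrier_is_subring by simp
  qed
qed

text \<open>Over a common denominator c, the square of a commutator is (x, y)^2 / c^4, and both
  vanishing and centrality are decided by the numerator.\<close>

lemma localization_central_squares: "ring_central_squares (localization R)"
  unfolding localization_def
proof (intro ring_central_squares.intro ring_central_squares_axioms.intro Loc.ring_fractions)
  obtain x y where xy: "x \<in> carrier R" "y \<in> carrier R" "x \<otimes> y \<noteq> y \<otimes> x"
    by (rule noncommuting_obtains[OF noncomm])
  then have "\<one> \<otimes> (x \<otimes> y) \<noteq> \<one> \<otimes> (y \<otimes> x)" by simp
  then have "ring_frac R (center R) x \<one> \<otimes>\<^bsub>fractions R (center R)\<^esub> ring_frac R (center R) y \<one> \<noteq>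
      ring_frac R (center R) y \<one> \<otimes>\<^bsub>fractions R (center R)\<^esub> ring_frac R (center R) x \<one>"
    using xy Loc.one_denominator by (simp add: Loc.frac_mult Loc.frac_eq_iff)
  then show "\<not> cring (fractions R (center R))"
    using cring.cring_simprules(14) Loc.frac_closed[OF _ Loc.one_denominator] xy by metis
next
  fix X Y assume XY: "X \<in> carrier (fractions R (center R))" "Y \<in> carrier (fractions R (center R))"
  then obtain x y c where f: "x \<in> carrier R" "y \<in> carrier R" "c \<in> center R - {\<zero>}"
    "X = Loc.frac x c" "Y = Loc.frac y c"
    by (rule Loc.frac_cases2)
  note cc = Loc.S_mult[OF f(3,3)]
  show "X = \<zero>\<^bsub>fractions R (center R)\<^esub> \<or> Y = \<zero>\<^bsub>fractions R (center R)\<^esub>"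
    if "X \<otimes>\<^bsub>fractions R (center R)\<^esub> Y = \<zero>\<^bsub>fractions R (center R)\<^esub>"
    using that f(1-3) cc integral[of x y] unfolding f(4,5)
    by (simp add: Loc.frac_mult Loc.frac_eq_zero_iff)
  show "commutator (fractions R (center R)) X Y \<otimes>\<^bsub>fractions R (center R)\<^esub>
      commutator (fractions R (center R)) X Y \<in> center (fractions R (center R))"
    using f(1-3) cc Loc.S_mult[OF cc cc] commutator_square[of x y] unfolding f(4,5)
    by (simp add: Loc.frac_commutator Loc.frac_mult Loc.frac_center_iff)
next
  show "\<one>\<^bsub>fractions R (center R)\<^esub> \<oplus>\<^bsub>fractions R (center R)\<^esub> \<one>\<^bsub>fractions R (center R)\<^esub> \<noteq>
      \<zero>\<^bsub>fractions R (center R)\<^esub>"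
    using Loc.one_denominator two_neq_zero
    by (simp add: Loc.one_frac Loc.frac_add_same Loc.frac_eq_zero_iff)
qed

lemma localization_division_ring: "division_ring (localization R)"
  unfolding localization_def division_ring_def
proof (intro conjI subset_antisym subsetI)
  fix X assume X: "X \<in> Units (fractions R (center R))"
  have "\<one>\<^bsub>fractions R (center R)\<^esub> \<noteq> \<zero>\<^bsub>fractions R (center R)\<^esub>"
    using Loc.one_denominator Loc.one_neq_zero by (simp add: Loc.one_frac Loc.frac_eq_zero_iff)
  then have "X \<noteq> \<zero>\<^bsub>fractions R (center R)\<^esub>"
    using X Loc.L.r_null unfolding Units_def by force
  with X show "X \<in> carrier (fractions R (center R)) - {\<zero>\<^bsub>fractions R (center R)\<^esub>}"
    by (simp add: Units_def)
next
  fix X assume X: "X \<in> carrier (fractions R (center R)) - {\<zero>\<^bsub>fractions R (center R)\<^esub>}"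
  then obtain x c where f: "x \<in> carrier R" "c \<in> center R - {\<zero>}" "X = Loc.frac x c"
    using Loc.frac_cases by blast
  then have "x \<noteq> \<zero>" using X by (simp add: Loc.frac_eq_zero_iff)
  then obtain s where s: "s \<in> carrier R" "x \<otimes> s \<in> center R" "x \<otimes> s \<noteq> \<zero>" "s \<otimes> x = x \<otimes> s"
    using ex_central_multiple f by blast
  \<comment> \<open>\<open>z\<close> is an admissible denominator, and the inverse of x / c is c s /
    z: both products have numerator and denominator equal to c z.\<close>
  define z where "z = x \<otimes> s"
  have z: "z \<in> center R - {\<zero>}" using s by (simp add: z_def)
  have cz: "c \<otimes> z \<in> center R - {\<zero>}" using Loc.S_mult f z by blast
  have cl: "c \<in> carrier R" "z \<in> carrier R" using f z center_carrier by auto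
  have "x \<otimes> (c \<otimes> s) = c \<otimes> z"
    using Loc.S_lcomm[of c x s] f s by (simp add: z_def)
  moreover have "c \<otimes> s \<otimes> x = c \<otimes> z" using f(1) s cl by (simp add: z_def m_assoc)
  moreover have "z \<otimes> c = c \<otimes> z" using center_comm[of z c] z cl by simp
  ultimately have "X \<otimes>\<^bsub>fractions R (center R)\<^esub> Loc.frac (c \<otimes> s) z = \<one>\<^bsub>fractions R (center R)\<^esub>"
    "Loc.frac (c \<otimes> s) z \<otimes>\<^bsub>fractions R (center R)\<^esub> X = \<one>\<^bsub>fractions R (center R)\<^esub>"
    using f s(1) z cl Loc.one_eq_frac[OF cz] by (simp_all add: Loc.frac_mult)
  then show "X \<in> Units (fractions R (center R))"
    using X Loc.frac_closed[of "c \<otimes> s" z] cl s(1) z unfolding Units_def by blast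
qed (rule Loc.ring_fractions)

lemma localization_quaternion:
  "quaternion_division_algebra (center (localization R)) (localization R)"
proof -
  interpret D: division_ring_central_squares "localization R"
    by (intro division_ring_central_squares.intro localization_central_squares
      division_ring_central_squares_axioms.intro localization_division_ring)
  show ?thesis by (rule D.quaternion_division_algebra_center)
qed

text \<open>Equality of fractions is the same equation over the center and over R, so x / c may be
  read in either ring; by \<open>frac_center_iff\<close> the fractions with central numerator are
  exactly the central ones.\<close>

lemma center_fraction_field_iso:
  "\<exists>\<phi> \<in> ring_iso (center_fraction_field R) ((localization R)\<lparr>carrier := center (localization R)\<rparr>).
    \<forall>x\<in>center R. \<forall>c\<in>center R - {\<zero>}.
      \<phi> (ring_frac (R\<lparr>carrier := center R\<rparr>) (center R) x c) = ring_frac R (center R) x c"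
proof -
  interpret K: central_denominators "R\<lparr>carrier := center R\<rparr>" "center R"
    by (rule center_integral_domain)
  \<comment> \<open>The union avoids choosing a representative: all pairs in a class give the same
    fraction over R.\<close>
  define \<phi> where "\<phi> X = (\<Union>p\<in>X. Loc.frac (fst p) (snd p))" for X :: "('a \<times> 'a) set"
  have \<phi>: "\<phi> (K.frac x c) = Loc.frac x c" if x: "x \<in> center R" and c: "c \<in> center R - {\<zero>}" for x c
  proof -
    have "Loc.frac (fst p) (snd p) = Loc.frac x c" if "p \<in> K.frac x c" for p
      using that x c center_carrier
      by (cases p) (auto simp: ring_frac_def[of "R\<lparr>carrier := center R\<rparr>"] K.frac_rel_iff Loc.frac_eq_iff)
    moreover have "(x, c) \<in> K.frac x c"
      using x c by (auto simp: ring_frac_def K.frac_rel_iff)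
    ultimately show ?thesis unfolding \<phi>_def by blast
  qed
  have cases: "\<exists>x\<in>center R. \<exists>c\<in>center R - {\<zero>}. X = K.frac x c"
    if "X \<in> carrier (fractions (R\<lparr>carrier := center R\<rparr>) (center R))" for X
    by (rule K.frac_cases[OF that]) auto
  have "\<phi> \<in> ring_iso (center_fraction_field R) ((localization R)\<lparr>carrier := center (localization R)\<rparr>)"
    unfolding ring_iso_def center_fraction_field_def localization_def
  proof (intro CollectI conjI ring_hom_memI)
    fix X assume "X \<in> carrier (fractions (R\<lparr>carrier := center R\<rparr>) (center R))"
    then obtain x c where f: "x \<in> center R" "c \<in> center R - {\<zero>}" "X = K.frac x c"
      using cases by blast
    then show "\<phi> X \<in> carrier (fractions R (center R)\<lparr>carrier := center (fractions R (center R))\<rparr>)"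
      by (simp add: \<phi> Loc.frac_center_iff center_carrier)
  next
    fix X Y
    assume "X \<in> carrier (fractions (R\<lparr>carrier := center R\<rparr>) (center R))"
      and "Y \<in> carrier (fractions (R\<lparr>carrier := center R\<rparr>) (center R))"
    then obtain x c y d where f: "x \<in> center R" "c \<in> center R - {\<zero>}" "X = K.frac x c"
      "y \<in> center R" "d \<in> center R - {\<zero>}" "Y = K.frac y d"
      using cases by meson
    note cd = Loc.S_mult[OF f(2,5)]
    have cl: "c \<in> center R" "d \<in> center R" using f by auto
    show "\<phi> (X \<otimes>\<^bsub>fractions (R\<lparr>carrier := center R\<rparr>) (center R)\<^esub> Y) =
        \<phi> X \<otimes>\<^bsub>fractions R (center R)\<lparr>carrier := center (fractions R (center R))\<rparr>\<^esub> \<phi> Y"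
      using f(1,2,4,5) cd K.frac_mult[of x c y d] unfolding f(3,6)
      by (simp add: \<phi> Loc.frac_mult center_carrier center_closed)
    show "\<phi> (X \<oplus>\<^bsub>fractions (R\<lparr>carrier := center R\<rparr>) (center R)\<^esub> Y) =
        \<phi> X \<oplus>\<^bsub>fractions R (center R)\<lparr>carrier := center (fractions R (center R))\<rparr>\<^esub> \<phi> Y"
      using f(1,2,4,5) cd cl K.frac_add[of x c y d] unfolding f(3,6)
      by (simp add: \<phi> Loc.frac_add center_carrier center_closed)
  next
    show "\<phi> \<one>\<^bsub>fractions (R\<lparr>carrier := center R\<rparr>) (center R)\<^esub> =
        \<one>\<^bsub>fractions R (center R)\<lparr>carrier := center (fractions R (center R))\<rparr>\<^esub>"
      using Loc.one_denominator by (simp add: K.one_frac Loc.one_frac \<phi>)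
  next
    show "bij_betw \<phi> (carrier (fractions (R\<lparr>carrier := center R\<rparr>) (center R)))
        (carrier (fractions R (center R)\<lparr>carrier := center (fractions R (center R))\<rparr>))"
    proof (rule bij_betw_imageI)
      show "inj_on \<phi> (carrier (fractions (R\<lparr>carrier := center R\<rparr>) (center R)))"
      proof (rule inj_onI)
        fix X Y
        assume "X \<in> carrier (fractions (R\<lparr>carrier := center R\<rparr>) (center R))"
          and "Y \<in> carrier (fractions (R\<lparr>carrier := center R\<rparr>) (center R))"
          and eq: "\<phi> X = \<phi> Y"
        then obtain x c y d where f: "x \<in> center R" "c \<in> center R - {\<zero>}" "X = K.frac x c"
          "y \<in> center R" "d \<in> center R - {\<zero>}" "Y = K.frac y d"
          using cases by meson
        with eq show "X = Y" by (simp add: \<phi> Loc.frac_eq_iff K.frac_eq_iff center_carrier)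
      qed
      show "\<phi> ` carrier (fractions (R\<lparr>carrier := center R\<rparr>) (center R)) =
          carrier (fractions R (center R)\<lparr>carrier := center (fractions R (center R))\<rparr>)"
      proof (intro subset_antisym image_subsetI subsetI)
        fix X assume "X \<in> carrier (fractions (R\<lparr>carrier := center R\<rparr>) (center R))"
        then obtain x c where "x \<in> center R" "c \<in> center R - {\<zero>}" "X = K.frac x c"
          using cases by blast
        then show "\<phi> X \<in> carrier (fractions R (center R)\<lparr>carrier := center (fractions R (center R))\<rparr>)"
          by (simp add: \<phi> Loc.frac_center_iff center_carrier)
      next
        fix Y assume "Y \<in> carrier (fractions R (center R)\<lparr>carrier := center (fractions R (center R))\<rparr>)"
        then have Y: "Y \<in> center (fractions R (center R))" by simp
        then obtain y d where f: "y \<in> carrier R" "d \<in> center R - {\<zero>}" "Y = Loc.frac y d"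
          using Loc.frac_cases Loc.L.center_carrier by blast
        then have "y \<in> center R" using Y Loc.frac_center_iff by blast
        then show "Y \<in> \<phi> ` carrier (fractions (R\<lparr>carrier := center R\<rparr>) (center R))"
          using f K.frac_closed[of y d] by (intro image_eqI[of _ _ "K.frac y d"]) (simp_all add: \<phi>)
      qed
    qed
  qed
  with \<phi> show ?thesis by blast
qed

end

lemma (in ring) one_plus_one_neq_zero:
  assumes "ring_char R \<noteq> 2" and "\<one> \<noteq> \<zero>"
  shows "\<one> \<oplus> \<one> \<noteq> \<zero>"
proof
  assume "\<one> \<oplus> \<one> = \<zero>"
  then have "add_pow R (2::nat) \<one> = \<zero>" by (simp add: numeral_2_eq_2)
  then have "ring_char R dvd 2" using add.pow_eq_id[of \<one> 2] by (simp add: ring_char_def)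
  \<comment> \<open>The value 0, standing for infinite order, does not divide 2; additive order 1
    would mean that one is zero.\<close>
  with assms(1) have "ring_char R = 1"
    using dvd_imp_le[of "ring_char R" 2] by (cases "ring_char R = 0") auto
  then show False using assms(2) add.ord_eq_1[of \<one>] by (simp add: ring_char_def)
qed

text \<open>That the center is the fraction field is expressed by the canonical isomorphism, which
  preserves x / c, rather than by an arbitrary one.\<close>

theorem mainTheorem1:
  fixes R :: "('a, 'b) ring_scheme" (structure)
  assumes "ring R"
    and "\<not> cring R"
    and "\<And>x y. x \<in> carrier R \<Longrightarrow> y \<in> carrier R \<Longrightarrow> commutator R x y \<noteq> \<zero> \<Longrightarrow>
           \<not> zero_divisor R (commutator R x y)"
    and "\<And>x y. x \<in> carrier R \<Longrightarrow> y \<in> carrier R \<Longrightarrow>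
           commutator R x y [^] (2::nat) \<in> center R"
  shows "(\<nexists>x. zero_divisor R x) \<and>
    (ring_char R \<noteq> 2 \<longrightarrow>
      quaternion_division_algebra (center (localization R)) (localization R) \<and>
      (\<exists>\<phi> \<in> ring_iso (center_fraction_field R)
                ((localization R)\<lparr>carrier := center (localization R)\<rparr>).
        \<forall>x\<in>center R. \<forall>c\<in>center R - {\<zero>}.
          \<phi> (ring_frac (R\<lparr>carrier := center R\<rparr>) (center R) x c) = ring_frac R (center R) x c))"
proof -
  interpret ring R by fact
  note nzd = no_zero_divisors_if_commutators_regular[OF assms(2,3)]
  \<comment> \<open>The zero ring is commutative, so noncommutativity excludes it.\<close>
  have one: "\<one> \<noteq> \<zero>"
  proof
    assume "\<one> = \<zero>"
    then have "carrier R = {\<zero>}" using one_zeroD by blast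
    moreover obtain x y where "x \<in> carrier R" "y \<in> carrier R" "x \<otimes> y \<noteq> y \<otimes> x"
      by (rule noncommuting_obtains[OF assms(2)])
    ultimately show False by simp
  qed
  have "ring_central_squares R" if char: "ring_char R \<noteq> 2"
  proof (intro ring_central_squares.intro ring_central_squares_axioms.intro ring_axioms)
    show "\<not> cring R" by fact
    show "x = \<zero> \<or> y = \<zero>" if "x \<in> carrier R" "y \<in> carrier R" "x \<otimes> y = \<zero>" for x y
      using nzd that by blast
    show "\<one> \<oplus> \<one> \<noteq> \<zero>" using one_plus_one_neq_zero[OF char one] .
    show "commutator R x y \<otimes> commutator R x y \<in> center R"
      if "x \<in> carrier R" "y \<in> carrier R" for x y
      using assms(4)[OF that] that by (simp add: numeral_2_eq_2)
  qed
  then show ?thesis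
    using nzd ring_central_squares.localization_quaternion[of R]
      ring_central_squares.center_fraction_field_iso[of R]
    unfolding zero_divisor_def by blast
qed

end
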